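(* Let $d\ge 1$ and let $g, h_j, \sigma_{ij}:\mathbb{R}^d\to\mathbb{R}$, $i,j=1,\dots,d$, be smooth bounded functions with bounded derivatives, and let $f_j:\mathbb{R}^d\to\mathbb{R}$, $j=1,\dots,d$, be smooth functions with bounded derivatives (in particular the $f_j$ have at most linear growth). Define operators $$A_i\phi := \sum_{j=1}^d\sigma_{ji}\,\partial_j\phi + h_i\phi,\quad i=1,\dots,d,\qquad L\phi := \frac12\sum_{i,j=1}^d(\sigma\sigma^t)_{ij}\,\partial^2_{ij}\phi+\sum_{j=1}^d f_j\,\partial_j\phi+g\phi .$$ Then for every integer $p\ge 0$ the pair $(L,A)$, $A=(A_1,\dots,A_d)$, satisfies the Monotonicity inequality in $\|\cdot\|_p$: there is a constant $C=C(d,p,\sigma,f,g,h)>0$, not depending on $\phi$, such that $$2\langle\phi, L\phi\rangle_p+\sum_{i=1}^d\|A_i\phi\|_p^2\le C\|\phi\|_p^2\qquad\text{for all }\phi\in\mathcal{S}(\mathbb{R}^d).$$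
   Context: $\mathcal{S}(\mathbb{R}^d)$ is the space of real-valued Schwartz functions on $\mathbb{R}^d$. For multi-indices $\alpha,\beta\in\mathbb{Z}_+^d$ (non-negative integer entries), $|\alpha|=\alpha_1+\dots+\alpha_d$, $x^\alpha=x_1^{\alpha_1}\cdots x_d^{\alpha_d}$, and $\partial^\beta$ is the corresponding partial derivative; $\partial_j=\partial/\partial x_j$, $\partial^2_{ij}=\partial_i\partial_j$. For an integer $p\ge 0$, $$\langle\phi,\psi\rangle_p:=\sum_{|\alpha|+|\beta|\le 2p}\int_{\mathbb{R}^d}x^\alpha\partial^\beta\phi(x)\;x^\alpha\partial^\beta\psi(x)\,dx,\qquad \phi,\psi\in\mathcal{S}(\mathbb{R}^d),$$ with norm $\|\phi\|_p=\langle\phi,\phi\rangle_p^{1/2}$. The matrix $\sigma=(\sigma_{ij})_{d\times d}$ has transpose $\sigma^t$; $f=(f_1,\dots,f_d)$ and $h=(h_1,\dots,h_d)$. "Smooth" means $C^\infty$, and "with bounded derivatives" means that all partial derivatives of every order $\ge 1$ are bounded. *)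

theory Defs
  imports "HOL-Analysis.Analysis"
begin

definition partial :: "'d::finite \<Rightarrow> (real ^ 'd \<Rightarrow> real) \<Rightarrow> real ^ 'd \<Rightarrow> real" where
  "partial i \<phi> x = deriv (\<lambda>t. \<phi> (x + t *\<^sub>R axis i 1)) 0"

text \<open>Differentiability below is total (Frechet) differentiability; with continuity of the
  partial derivatives of order \<open>k\<close> this is the usual class \<open>C\<^sup>k\<close>.\<close>

primrec C_times :: "nat \<Rightarrow> (real ^ 'd::finite \<Rightarrow> real) \<Rightarrow> bool" where
  "C_times 0 \<phi> \<longleftrightarrow> continuous_on UNIV \<phi>"
| "C_times (Suc k) \<phi> \<longleftrightarrow> (\<forall>x. \<phi> differentiable (at x)) \<and> (\<forall>i. C_times k (partial i \<phi>))"

definition smooth :: "(real ^ 'd::finite \<Rightarrow> real) \<Rightarrow> bool" where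
  "smooth \<phi> \<longleftrightarrow> (\<forall>k. C_times k \<phi>)"

text \<open>Multi-indices are functions on the coordinate type. That type carries no order, so
  \<open>coords\<close> fixes an enumeration of the coordinates in which to form \<open>\<partial>\<^sup>\<beta>\<close>; on smooth
  functions the partial derivatives commute and the choice is immaterial.\<close>

type_synonym 'd multi_index = "'d \<Rightarrow> nat"

definition coords :: "'d::finite list" where
  "coords = (SOME is. set is = UNIV \<and> distinct is)"

lemma coords: "set (coords :: 'd::finite list) = UNIV" "distinct (coords :: 'd list)"
proof -
  have "set (coords :: 'd list) = UNIV \<and> distinct (coords :: 'd list)"
    unfolding coords_def by (rule someI_ex) (rule finite_distinct_list, simp)
  then show "set (coords :: 'd list) = UNIV" "distinct (coords :: 'd list)"
    by auto
qed

definition mi_order :: "'d::finite multi_index \<Rightarrow> nat" where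
  "mi_order \<alpha> = (\<Sum>i\<in>UNIV. \<alpha> i)"

definition monomial :: "'d::finite multi_index \<Rightarrow> real ^ 'd \<Rightarrow> real" where
  "monomial \<alpha> x = (\<Prod>i\<in>UNIV. (x $ i) ^ \<alpha> i)"

definition mderiv :: "'d::finite multi_index \<Rightarrow> (real ^ 'd \<Rightarrow> real) \<Rightarrow> real ^ 'd \<Rightarrow> real" where
  "mderiv \<beta> = foldr (\<lambda>i. partial i ^^ \<beta> i) coords"

definition bounded_derivatives :: "(real ^ 'd::finite \<Rightarrow> real) \<Rightarrow> bool" where
  "bounded_derivatives \<phi> \<longleftrightarrow> (\<forall>\<beta>. mi_order \<beta> \<ge> 1 \<longrightarrow> bounded (range (mderiv \<beta> \<phi>)))"

definition schwartz :: "(real ^ 'd::finite \<Rightarrow> real) set" where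
  "schwartz = {\<phi>. smooth \<phi> \<and> (\<forall>\<alpha> \<beta>. bounded (range (\<lambda>x. monomial \<alpha> x * mderiv \<beta> \<phi> x)))}"

definition inner_p :: "nat \<Rightarrow> (real ^ 'd::finite \<Rightarrow> real) \<Rightarrow> (real ^ 'd \<Rightarrow> real) \<Rightarrow> real" where
  "inner_p p \<phi> \<psi> = (\<Sum>(\<alpha>, \<beta>) \<in> {(\<alpha>, \<beta>). mi_order \<alpha> + mi_order \<beta> \<le> 2 * p}.
     LINT x|lborel. (monomial \<alpha> x * mderiv \<beta> \<phi> x) * (monomial \<alpha> x * mderiv \<beta> \<psi> x))"

definition norm_p :: "nat \<Rightarrow> (real ^ 'd::finite \<Rightarrow> real) \<Rightarrow> real" where
  "norm_p p \<phi> = sqrt (inner_p p \<phi> \<phi>)"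

lemma finite_mi_order_le:
  "finite {(\<alpha> :: 'd::finite multi_index, \<beta> :: 'd multi_index). mi_order \<alpha> + mi_order \<beta> \<le> n}"
proof -
  have le: "\<alpha> i \<le> mi_order \<alpha>" for \<alpha> :: "'d multi_index" and i
    unfolding mi_order_def by (rule member_le_sum) auto
  let ?F = "PiE (UNIV :: 'd set) (\<lambda>_. {..n})"
  have "{(\<alpha> :: 'd multi_index, \<beta> :: 'd multi_index). mi_order \<alpha> + mi_order \<beta> \<le> n} \<subseteq> ?F \<times> ?F"
    by (auto simp: PiE_def intro: order_trans[OF le])
  then show ?thesis
    by (rule finite_subset) (intro finite_cartesian_product finite_PiE; simp)
qed

definition op_A :: "(real ^ 'd::finite \<Rightarrow> real ^ 'd ^ 'd) \<Rightarrow> (real ^ 'd \<Rightarrow> real ^ 'd) \<Rightarrow> 'd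
    \<Rightarrow> (real ^ 'd \<Rightarrow> real) \<Rightarrow> real ^ 'd \<Rightarrow> real" where
  "op_A \<sigma> h i \<phi> x = (\<Sum>j\<in>UNIV. \<sigma> x $ j $ i * partial j \<phi> x) + h x $ i * \<phi> x"

definition op_L :: "(real ^ 'd::finite \<Rightarrow> real ^ 'd ^ 'd) \<Rightarrow> (real ^ 'd \<Rightarrow> real ^ 'd)
    \<Rightarrow> (real ^ 'd \<Rightarrow> real) \<Rightarrow> (real ^ 'd \<Rightarrow> real) \<Rightarrow> real ^ 'd \<Rightarrow> real" where
  "op_L \<sigma> f g \<phi> x =
     1 / 2 * (\<Sum>i\<in>UNIV. \<Sum>j\<in>UNIV. (\<sigma> x ** transpose (\<sigma> x)) $ i $ j * partial i (partial j \<phi>) x)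
     + (\<Sum>j\<in>UNIV. f x $ j * partial j \<phi> x) + g x * \<phi> x"

end

theory Submission
  imports Defs "HOL-Probability.Sinc_Integral" "HOL-Library.Multiset"
begin

text \<open>Put \<open>D\<^sub>i \<phi> = \<Sum>\<^sub>j \<sigma>\<^sub>j\<^sub>i \<partial>\<^sub>j \<phi>\<close>, so that \<open>L = 1/2 \<Sum>\<^sub>i D\<^sub>i D\<^sub>i\<close> up to a first-order operator whose drift again has bounded
  derivatives, and \<open>A\<^sub>i = D\<^sub>i + h\<^sub>i\<close>. Count each derivative and each factor of linear growth as order one. For
  \<open>T = x\<^sup>\<alpha> \<partial>\<^sup>\<beta>\<close> of order at most \<open>2 p\<close>, commutators with \<open>D\<^sub>i\<close> and with the drift do not raise the order, and
  commutators with \<open>h\<^sub>i\<close> lower it. Hence \<open>\<langle>T \<phi>, T D\<^sub>i D\<^sub>i \<phi>\<rangle> + \<parallel>T A\<^sub>i \<phi>\<parallel>\<^sup>2\<close> reduces, by commuting \<open>T\<close> to the right place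
  and integrating by parts once, to pairings of operators of order at most \<open>2 p\<close>: the dangerous
  terms \<open>\<parallel>D\<^sub>i T \<phi>\<parallel>\<^sup>2\<close> and \<open>\<langle>D\<^sub>i T \<phi>, [T, D\<^sub>i] \<phi>\<rangle>\<close> cancel.\<close>

section \<open>Partial derivatives of smooth functions\<close>

text \<open>The symbol classes gain nothing from differentiation: a derivative of a coefficient of
  growth m is again only of growth m. For the fields D_i this is enough, since their coefficients
  are bounded: [T, D_i] has order 2 p for every operator T of order 2 p, so the double commutator is
  admissible as well. For a drift F \<partial>_j with F of linear growth it is not:
  [c \<partial>^\<beta>, F \<partial>_j] contains F (\<partial>_j c) \<partial>^\<beta>, one order
  too many for general c. For c = x^\<alpha> the degree drops under \<partial>_j and compensates F.
  Hence the drift is commuted only once, and only with the monomial operators that define the norm.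
  Since \<sigma> may degenerate, nothing is available to absorb the terms containing D_i T \<phi>.
  They have to cancel exactly, so everything is kept as an identity between integrals until only
  terms bounded by the norm remain. The estimate then holds for the absolute value of the left-hand
  side, and for each pair (\<alpha>, \<beta>) separately.\<close>

lemma partial_eq_derivative:
  fixes f :: "real ^ 'd::finite \<Rightarrow> real"
  assumes "(f has_derivative f') (at x)"
  shows "partial i f x = f' (axis i 1)"
proof -
  have "((\<lambda>t. x + t *\<^sub>R axis i (1::real)) has_derivative (\<lambda>t. t *\<^sub>R axis i 1)) (at 0)"
    by (auto intro!: derivative_eq_intros)
  moreover have "(f has_derivative f') (at (x + 0 *\<^sub>R axis i (1::real)))"
    using assms by simp
  ultimately have "((\<lambda>t. f (x + t *\<^sub>R axis i 1)) has_derivative (\<lambda>t. f' (t *\<^sub>R axis i 1))) (at 0)"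
    using has_derivative_compose by blast
  moreover have "f' (t *\<^sub>R axis i 1) = f' (axis i 1) * t" for t
    using assms by (simp add: has_derivative_bounded_linear linear_simps(5))
  ultimately have "((\<lambda>t. f (x + t *\<^sub>R axis i 1)) has_field_derivative f' (axis i 1)) (at 0)"
    by (simp add: has_field_derivative_def)
  then show ?thesis
    unfolding partial_def by (rule DERIV_imp_deriv)
qed

lemma has_derivative_partial:
  fixes f :: "real ^ 'd::finite \<Rightarrow> real"
  assumes "f differentiable (at x)"
  shows "(f has_derivative (\<lambda>v. \<Sum>i\<in>UNIV. v $ i * partial i f x)) (at x)"
proof -
  obtain f' where f': "(f has_derivative f') (at x)"
    using assms unfolding differentiable_def by blast
  interpret bounded_linear f' using f' by (rule has_derivative_bounded_linear)
  have "f' v = (\<Sum>i\<in>UNIV. v $ i * partial i f x)" for v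
  proof -
    have "f' v = f' (\<Sum>i\<in>UNIV. v $ i *\<^sub>R axis i 1)"
      by (simp add: basis_expansion scalar_mult_eq_scaleR[symmetric])
    also have "\<dots> = (\<Sum>i\<in>UNIV. v $ i * partial i f x)"
      by (simp add: sum scaleR partial_eq_derivative[OF f'])
    finally show ?thesis .
  qed
  then show ?thesis using f' by presburger
qed

text \<open>\<open>partial\<close> is a derivative at parameter 0 only. Moving the base point gives
  the derivative along the whole line, as the mean value theorem requires.\<close>

lemma has_field_derivative_partial_line:
  fixes f :: "real ^ 'd::finite \<Rightarrow> real"
  assumes "f differentiable (at (x + t *\<^sub>R axis i 1))"
  shows "((\<lambda>t. f (x + t *\<^sub>R axis i 1)) has_field_derivative partial i f (x + t *\<^sub>R axis i 1)) (at t)"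
proof -
  have "((\<lambda>t. x + t *\<^sub>R axis i (1::real)) has_derivative (\<lambda>t. t *\<^sub>R axis i 1)) (at t)"
    by (auto intro!: derivative_eq_intros)
  from has_derivative_compose[OF this has_derivative_partial[OF assms]]
  have "((\<lambda>t. f (x + t *\<^sub>R axis i 1)) has_derivative
     (\<lambda>s. \<Sum>j\<in>UNIV. (s *\<^sub>R axis i 1) $ j * partial j f (x + t *\<^sub>R axis i 1))) (at t)" .
  moreover have "(\<lambda>s. \<Sum>j\<in>UNIV. (s *\<^sub>R axis i 1) $ j * partial j f (x + t *\<^sub>R axis i 1))
    = (*) (partial i f (x + t *\<^sub>R axis i 1))"
    by (rule ext) (simp add: axis_def if_distrib[of "\<lambda>y. _ * y"] if_distrib[of "\<lambda>y. y * _"] mult.commute cong: if_cong)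
  ultimately show ?thesis by (simp add: has_field_derivative_def)
qed

section \<open>Closure properties of smooth functions\<close>

lemma C_times_continuous: "C_times k f \<Longrightarrow> continuous_on UNIV f"
  by (cases k) (auto simp: differentiable_imp_continuous_within intro!: continuous_at_imp_continuous_on)

lemma C_times_Suc_imp: "C_times (Suc k) f \<Longrightarrow> C_times k f"
  by (induction k arbitrary: f) (auto simp: differentiable_imp_continuous_within intro!: continuous_at_imp_continuous_on)

lemma smooth_differentiable: "smooth f \<Longrightarrow> f differentiable (at x)"
  unfolding smooth_def by (metis C_times.simps(2))

lemma smooth_partial: "smooth f \<Longrightarrow> smooth (partial i f)"
  unfolding smooth_def by (metis C_times.simps(2))

lemma smooth_continuous: "smooth f \<Longrightarrow> continuous_on UNIV f"
  unfolding smooth_def using C_times_continuous by blast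

lemma smoothI: "(\<And>x. f differentiable (at x)) \<Longrightarrow> (\<And>i. smooth (partial i f)) \<Longrightarrow> smooth f"
  unfolding smooth_def by (metis C_times.simps(2) C_times_Suc_imp)

lemma partial_const [simp]: "partial i (\<lambda>x. c) = (\<lambda>x. 0)"
  by (rule ext) (simp add: partial_def)

lemma partial_add:
  assumes "f differentiable (at x)" "g differentiable (at x)"
  shows "partial i (\<lambda>x. f x + g x) x = partial i f x + partial i g x"
  using partial_eq_derivative[OF has_derivative_add[OF assms[THEN has_derivative_partial]], of i]
    assms[THEN has_derivative_partial, THEN partial_eq_derivative, of i]
  by simp

lemma partial_mult:
  assumes "f differentiable (at x)" "g differentiable (at x)"
  shows "partial i (\<lambda>x. f x * g x) x = f x * partial i g x + partial i f x * g x"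
  using partial_eq_derivative[OF has_derivative_mult[OF assms[THEN has_derivative_partial]], of i]
    assms[THEN has_derivative_partial, THEN partial_eq_derivative, of i]
  by simp

lemma partial_component: "partial i (\<lambda>x. x $ j) = (\<lambda>x. if i = j then 1 else 0)"
proof
  fix x :: "real ^ 'a"
  have "((\<lambda>x. x $ j) has_derivative (\<lambda>v. v $ j)) (at x)"
    by (rule bounded_linear_imp_has_derivative[OF bounded_linear_vec_nth])
  from partial_eq_derivative[OF this] show "partial i (\<lambda>x. x $ j) x = (if i = j then 1 else 0)"
    by (simp add: axis_def)
qed

lemma smooth_const [simp]: "smooth (\<lambda>x. c)"
proof -
  have "C_times k (\<lambda>x :: real ^ 'a. c)" for k and c :: real
    by (induction k arbitrary: c) auto
  then show ?thesis by (simp add: smooth_def)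
qed

lemma smooth_component [simp]: "smooth (\<lambda>x. x $ j)"
  by (rule smoothI)
     (auto simp: partial_component intro!: bounded_linear_imp_differentiable bounded_linear_vec_nth)

lemma C_times_add: "C_times k f \<Longrightarrow> C_times k g \<Longrightarrow> C_times k (\<lambda>x. f x + g x)"
proof (induction k arbitrary: f g)
  case 0
  then show ?case by (auto intro!: continuous_on_add)
next
  case (Suc k)
  have "partial i (\<lambda>x. f x + g x) = (\<lambda>x. partial i f x + partial i g x)" for i
    using Suc.prems by (intro ext partial_add) auto
  then show ?case
    using Suc by (auto intro: differentiable_add)
qed

lemma C_times_mult: "C_times k f \<Longrightarrow> C_times k g \<Longrightarrow> C_times k (\<lambda>x. f x * g x)"
proof (induction k arbitrary: f g)
  case 0
  then show ?case by (auto intro!: continuous_on_mult)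
next
  case (Suc k)
  have "partial i (\<lambda>x. f x * g x) = (\<lambda>x. f x * partial i g x + partial i f x * g x)" for i
    using Suc.prems by (intro ext partial_mult) auto
  then show ?case
    using Suc C_times_Suc_imp[OF Suc.prems(1)] C_times_Suc_imp[OF Suc.prems(2)]
    by (auto intro!: differentiable_mult C_times_add)
qed

lemma smooth_add: "smooth f \<Longrightarrow> smooth g \<Longrightarrow> smooth (\<lambda>x. f x + g x)"
  by (simp add: smooth_def C_times_add)

lemma smooth_mult: "smooth f \<Longrightarrow> smooth g \<Longrightarrow> smooth (\<lambda>x. f x * g x)"
  by (simp add: smooth_def C_times_mult)

text \<open>The left-hand side is symmetric in \<open>i\<close> and \<open>j\<close>; letting \<open>h\<close> tend to \<open>0\<close> gives the symmetry of the
  second derivatives.\<close>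

lemma second_difference_mvt:
  fixes f :: "real ^ 'd::finite \<Rightarrow> real"
  assumes f: "smooth f" and h: "h > 0"
  shows "\<exists>s t. 0 < s \<and> s < h \<and> 0 < t \<and> t < h \<and>
    f (x + h *\<^sub>R axis i 1 + h *\<^sub>R axis j 1) - f (x + h *\<^sub>R axis i 1) - f (x + h *\<^sub>R axis j 1) + f x
    = h\<^sup>2 * partial j (partial i f) (x + s *\<^sub>R axis i 1 + t *\<^sub>R axis j 1)"
proof -
  let ?e = "axis i (1::real)" and ?e' = "axis j (1::real)"
  let ?F = "\<lambda>s. f (x + h *\<^sub>R ?e' + s *\<^sub>R ?e) - f (x + s *\<^sub>R ?e)"
  have "\<exists>s>0. s < h \<and> ?F h - ?F 0 = (h - 0) *
      (partial i f (x + h *\<^sub>R ?e' + s *\<^sub>R ?e) - partial i f (x + s *\<^sub>R ?e))"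
    by (rule MVT2[OF h])
       (intro DERIV_diff has_field_derivative_partial_line smooth_differentiable[OF f])
  then obtain s where s: "0 < s" "s < h" "?F h - ?F 0 = h *
      (partial i f (x + h *\<^sub>R ?e' + s *\<^sub>R ?e) - partial i f (x + s *\<^sub>R ?e))" by auto
  let ?G = "\<lambda>t. partial i f (x + s *\<^sub>R ?e + t *\<^sub>R ?e')"
  have "\<exists>t>0. t < h \<and> ?G h - ?G 0 = (h - 0) * partial j (partial i f) (x + s *\<^sub>R ?e + t *\<^sub>R ?e')"
    by (rule MVT2[OF h])
       (intro has_field_derivative_partial_line smooth_differentiable smooth_partial f)
  then obtain t where t: "0 < t" "t < h"
    "?G h - ?G 0 = h * partial j (partial i f) (x + s *\<^sub>R ?e + t *\<^sub>R ?e')" by auto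
  have "f (x + h *\<^sub>R ?e + h *\<^sub>R ?e') - f (x + h *\<^sub>R ?e) - f (x + h *\<^sub>R ?e') + f x = ?F h - ?F 0"
    by (simp add: algebra_simps)
  also have "\<dots> = h * (?G h - ?G 0)"
    using s(3) by (simp add: algebra_simps)
  also have "\<dots> = h\<^sup>2 * partial j (partial i f) (x + s *\<^sub>R ?e + t *\<^sub>R ?e')"
    using t(3) by (simp add: power2_eq_square)
  finally show ?thesis using s(1,2) t(1,2) by blast
qed

lemma partial_commute:
  fixes f :: "real ^ 'd::finite \<Rightarrow> real"
  assumes f: "smooth f"
  shows "partial i (partial j f) = partial j (partial i f)"
proof
  fix x :: "real ^ 'd"
  let ?a = "partial i (partial j f)" and ?b = "partial j (partial i f)"
  have near: "dist (x + s *\<^sub>R axis k 1 + t *\<^sub>R axis l 1) x < d"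
    if "0 < s" "0 < t" "s < d / 2" "t < d / 2" for s t d :: real and k l :: 'd
  proof -
    have "dist (x + s *\<^sub>R axis k 1 + t *\<^sub>R axis l 1) x \<le> \<bar>s\<bar> + \<bar>t\<bar>"
      using norm_triangle_ineq[of "s *\<^sub>R axis k (1::real)" "t *\<^sub>R axis l 1"]
      by (simp add: dist_norm add.assoc)
    then show ?thesis using that by linarith
  qed
  have "\<bar>?a x - ?b x\<bar> \<le> e" if e: "e > 0" for e
  proof -
    have "isCont ?a x" "isCont ?b x"
      by (metis UNIV_I continuous_on_eq_continuous_at open_UNIV smooth_continuous smooth_partial f)+
    moreover have "e / 2 > 0" using e by simp
    ultimately obtain d1 d2 where d: "d1 > 0" "d2 > 0"
      "\<And>y. dist y x < d1 \<Longrightarrow> dist (?a y) (?a x) < e / 2"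
      "\<And>y. dist y x < d2 \<Longrightarrow> dist (?b y) (?b x) < e / 2"
      unfolding continuous_at_eps_delta by (metis)
    \<comment> \<open>\<open>near\<close> needs both offsets of an intermediate point below half of
      the continuity radius, hence the factor 1/2.\<close>
    define h where "h = min d1 d2 / 2"
    have h: "h > 0" "h \<le> d1 / 2" "h \<le> d2 / 2" using d(1,2) by (auto simp: h_def)
    obtain s t where st: "0 < s" "s < h" "0 < t" "t < h"
      "f (x + h *\<^sub>R axis i 1 + h *\<^sub>R axis j 1) - f (x + h *\<^sub>R axis i 1) - f (x + h *\<^sub>R axis j 1) + f x
        = h\<^sup>2 * ?b (x + s *\<^sub>R axis i 1 + t *\<^sub>R axis j 1)"
      using second_difference_mvt[OF f h(1)] by blast
    obtain s' t' where st': "0 < s'" "s' < h" "0 < t'" "t' < h"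
      "f (x + h *\<^sub>R axis j 1 + h *\<^sub>R axis i 1) - f (x + h *\<^sub>R axis j 1) - f (x + h *\<^sub>R axis i 1) + f x
        = h\<^sup>2 * ?a (x + s' *\<^sub>R axis j 1 + t' *\<^sub>R axis i 1)"
      using second_difference_mvt[OF f h(1)] by blast
    have "h\<^sup>2 * ?b (x + s *\<^sub>R axis i 1 + t *\<^sub>R axis j 1) = h\<^sup>2 * ?a (x + s' *\<^sub>R axis j 1 + t' *\<^sub>R axis i 1)"
      unfolding st(5)[symmetric] st'(5)[symmetric] by (simp add: algebra_simps)
    then have eq: "?b (x + s *\<^sub>R axis i 1 + t *\<^sub>R axis j 1) = ?a (x + s' *\<^sub>R axis j 1 + t' *\<^sub>R axis i 1)"
      using h(1) by simp
    have "dist (?b (x + s *\<^sub>R axis i 1 + t *\<^sub>R axis j 1)) (?b x) < e / 2"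
      by (rule d(4), rule near) (use st h in auto)
    moreover have "dist (?a (x + s' *\<^sub>R axis j 1 + t' *\<^sub>R axis i 1)) (?a x) < e / 2"
      by (rule d(3), rule near) (use st' h in auto)
    ultimately show ?thesis unfolding eq dist_real_def by linarith
  qed
  then have "\<bar>?a x - ?b x\<bar> \<le> 0" by (rule field_le_epsilon[of _ 0, simplified])
  then show "?a x = ?b x" by simp
qed

section \<open>Symbol classes and the Schwartz space\<close>

text \<open>Lists replace multi-indices because the Leibniz rule and the commutators are proved by
  peeling off one derivative at either end. Multi-indices return only where the definitions of the
  norm, the Schwartz space and bounded derivatives are unfolded.\<close>

definition pd :: "'d::finite list \<Rightarrow> (real ^ 'd \<Rightarrow> real) \<Rightarrow> real ^ 'd \<Rightarrow> real" where
  "pd ks f = foldr partial ks f"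

lemma pd_Nil [simp]: "pd [] f = f"
  and pd_Cons [simp]: "pd (k # ks) f = partial k (pd ks f)"
  and pd_append: "pd (ks @ ls) f = pd ks (pd ls f)"
  by (simp_all add: pd_def)

lemma smooth_pd: "smooth f \<Longrightarrow> smooth (pd ks f)"
  by (induction ks) (auto intro: smooth_partial)

lemma pd_partial_commute: "smooth f \<Longrightarrow> pd ks (partial k f) = partial k (pd ks f)"
  by (induction ks) (auto simp: partial_commute smooth_pd)

text \<open>The head of \<open>ks\<close> occurs somewhere in \<open>ls\<close> and is commuted past
  the prefix in front of it; the tails then agree as multisets.\<close>

lemma pd_mset_cong: "smooth f \<Longrightarrow> mset ks = mset ls \<Longrightarrow> pd ks f = pd ls f"
proof (induction ks arbitrary: ls)
  case (Cons k ks)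
  have "k \<in> set ls" using Cons.prems(2) by (metis list.set_intros(1) mset_eq_setD)
  then obtain as bs where ls: "ls = as @ k # bs" by (meson split_list)
  then have "mset ks = mset (as @ bs)" using Cons.prems(2) by simp
  then have "pd ks f = pd (as @ bs) f" using Cons by blast
  then show ?case
    using Cons.prems(1) by (simp add: ls pd_append pd_partial_commute smooth_pd)
qed simp

lemma mderiv_eq_pd:
  "\<exists>ks. length ks = mi_order \<beta> \<and> (\<forall>f. mderiv \<beta> f = pd ks f)"
proof -
  let ?ks = "\<lambda>cs. concat (map (\<lambda>i. replicate (\<beta> i) i) cs)"
  have "foldr (\<lambda>i. partial i ^^ \<beta> i) cs f = pd (?ks cs) f" for cs f
    by (induction cs) (auto simp: pd_append, simp add: pd_def foldr_replicate)
  moreover have "length (?ks coords) = mi_order \<beta>"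
    by (simp add: length_concat comp_def mi_order_def sum_list_distinct_conv_sum_set coords)
  ultimately show ?thesis unfolding mderiv_def by blast
qed

text \<open>A given list has to be rearranged into the order of \<open>coords\<close>, so this
  direction rests on the symmetry of second derivatives and is restricted to smooth functions. The
  multi-index counts the occurrences of each coordinate.\<close>

lemma pd_eq_mderiv:
  fixes ks :: "'a::finite list"
  shows "\<exists>\<beta>. mi_order \<beta> = length ks \<and> (\<forall>f. smooth f \<longrightarrow> pd ks f = mderiv \<beta> f)"
proof -
  define \<beta> where "\<beta> = count (mset ks)"
  let ?ks = "\<lambda>cs. concat (map (\<lambda>i. replicate (\<beta> i) i) cs)"
  have pd: "foldr (\<lambda>i. partial i ^^ \<beta> i) cs f = pd (?ks cs) f" for cs f
    by (induction cs) (auto simp: pd_append, simp add: pd_def foldr_replicate)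
  have cnt: "distinct cs \<Longrightarrow> count (mset (?ks cs)) j = (if j \<in> set cs then \<beta> j else 0)" for cs j
    by (induction cs) auto
  have "mset (?ks coords) = mset ks"
    by (intro multiset_eqI, subst cnt) (simp_all add: coords \<beta>_def)
  from pd_mset_cong[OF _ this[symmetric]]
  have "smooth f \<longrightarrow> pd ks f = mderiv \<beta> f" for f :: "real ^ 'a \<Rightarrow> real"
    unfolding mderiv_def pd by blast
  moreover have "mi_order \<beta> = length ks"
    unfolding mi_order_def \<beta>_def size_mset[symmetric] size_multiset_overloaded_eq
    by (rule sum.mono_neutral_right) (auto simp: count_eq_zero_iff)
  ultimately show ?thesis by blast
qed

lemma pd_zero [simp]: "pd ks (\<lambda>x. 0) = (\<lambda>x. 0)"
  by (induction ks) auto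

lemma pd_add: "smooth f \<Longrightarrow> smooth g \<Longrightarrow> pd ks (\<lambda>x. f x + g x) = (\<lambda>x. pd ks f x + pd ks g x)"
proof (induction ks)
  case (Cons k ks)
  have "partial k (\<lambda>x. pd ks f x + pd ks g x) x = partial k (pd ks f) x + partial k (pd ks g) x" for x
    by (intro partial_add smooth_differentiable smooth_pd Cons.prems)
  then show ?case using Cons by simp
qed simp

lemma partial_mult_smooth:
  "smooth f \<Longrightarrow> smooth g \<Longrightarrow> partial i (\<lambda>x. f x * g x) = (\<lambda>x. f x * partial i g x + partial i f x * g x)"
  by (rule ext, rule partial_mult) (rule smooth_differentiable, assumption)+

text \<open>The order \<open>m\<close> may be negative, so that the Schwartz space is the intersection of all these classes.\<close>

definition symb :: "int \<Rightarrow> (real ^ 'd::finite \<Rightarrow> real) \<Rightarrow> bool" where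
  "symb m f \<longleftrightarrow> smooth f \<and> (\<forall>ks. \<exists>C. \<forall>x. \<bar>pd ks f x\<bar> \<le> C * (1 + norm x) powi m)"

lemma symb_smooth: "symb m f \<Longrightarrow> smooth f"
  by (simp add: symb_def)

lemma weight_powi_pos [simp]: "0 < (1 + norm x) powi m"
  by (simp add: add_pos_nonneg)

lemma symb_pd_bound:
  assumes "symb m f"
  obtains C where "C \<ge> 0" "\<And>x. \<bar>pd ks f x\<bar> \<le> C * (1 + norm x) powi m"
proof -
  obtain C where C: "\<And>x. \<bar>pd ks f x\<bar> \<le> C * (1 + norm x) powi m"
    using assms unfolding symb_def by meson
  \<comment> \<open>The weight equals 1 at the origin, so any admissible constant is automatically
    nonnegative.\<close>
  have "0 \<le> \<bar>pd ks f 0\<bar>" by simp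
  also have "\<dots> \<le> C" using C[of 0] by simp
  finally show ?thesis using C that by blast
qed

lemma symb0_pd_bound:
  assumes "symb 0 f"
  obtains C where "C \<ge> 0" "\<And>x. \<bar>pd ks f x\<bar> \<le> C"
  using symb_pd_bound[OF assms, of ks] by auto

lemma symb_mono: "symb m f \<Longrightarrow> m \<le> m' \<Longrightarrow> symb m' f"
proof -
  assume f: "symb m f" and le: "m \<le> m'"
  have "\<exists>C. \<forall>x. \<bar>pd ks f x\<bar> \<le> C * (1 + norm x) powi m'" for ks
  proof -
    obtain C where C: "C \<ge> 0" "\<And>x. \<bar>pd ks f x\<bar> \<le> C * (1 + norm x) powi m"
      using symb_pd_bound[OF f] by metis
    have "\<bar>pd ks f x\<bar> \<le> C * (1 + norm x) powi m'" for x
      by (rule order_trans[OF C(2)]) (use C(1) le in \<open>auto intro!: mult_left_mono power_int_increasing\<close>)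
    then show ?thesis by blast
  qed
  then show ?thesis using f by (simp add: symb_def)
qed

lemma symb_partial: "symb m f \<Longrightarrow> symb m (partial i f)"
proof -
  assume f: "symb m f"
  have "\<exists>C. \<forall>x. \<bar>pd ks (partial i f) x\<bar> \<le> C * (1 + norm x) powi m" for ks
  proof -
    obtain C where "\<And>x. \<bar>pd (ks @ [i]) f x\<bar> \<le> C * (1 + norm x) powi m"
      using symb_pd_bound[OF f] by metis
    then show ?thesis by (auto simp: pd_append)
  qed
  then show ?thesis using f by (simp add: symb_def smooth_partial)
qed

lemma symb_pd: "symb m f \<Longrightarrow> symb m (pd ks f)"
  by (induction ks) (auto intro: symb_partial)

lemma symb_add: "symb m f \<Longrightarrow> symb m g \<Longrightarrow> symb m (\<lambda>x. f x + g x)"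
proof -
  assume f: "symb m f" and g: "symb m g"
  have "\<exists>C. \<forall>x. \<bar>pd ks (\<lambda>x. f x + g x) x\<bar> \<le> C * (1 + norm x) powi m" for ks
  proof -
    obtain C where C: "\<And>x. \<bar>pd ks f x\<bar> \<le> C * (1 + norm x) powi m"
      using symb_pd_bound[OF f] by metis
    obtain D where D: "\<And>x. \<bar>pd ks g x\<bar> \<le> D * (1 + norm x) powi m"
      using symb_pd_bound[OF g] by metis
    have "\<bar>pd ks (\<lambda>x. f x + g x) x\<bar> \<le> (C + D) * (1 + norm x) powi m" for x
      using C[of x] D[of x] f g by (simp add: pd_add symb_smooth distrib_right)
    then show ?thesis by blast
  qed
  then show ?thesis using f g by (simp add: symb_def smooth_add)
qed

text \<open>The last entry of a list is the derivative applied to the product itself. Peeling it off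
  gives two products of functions of the same classes, to which the induction hypothesis for the
  shorter list applies.\<close>

lemma symb_mult: "symb m f \<Longrightarrow> symb l g \<Longrightarrow> symb (m + l) (\<lambda>x. f x * g x)"
proof -
  have "\<exists>C. \<forall>x. \<bar>pd ks (\<lambda>x. f x * g x) x\<bar> \<le> C * (1 + norm x) powi (m + l)"
    if "symb m f" "symb l g" for ks f g
    using that
  proof (induction ks arbitrary: f g rule: rev_induct)
    case Nil
    obtain C where C: "C \<ge> 0" "\<And>x. \<bar>f x\<bar> \<le> C * (1 + norm x) powi m"
      using symb_pd_bound[OF Nil(1), of "[]"] by auto
    obtain D where D: "D \<ge> 0" "\<And>x. \<bar>g x\<bar> \<le> D * (1 + norm x) powi l"
      using symb_pd_bound[OF Nil(2), of "[]"] by auto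
    have "\<bar>f x * g x\<bar> \<le> (C * D) * (1 + norm x) powi (m + l)" for x
    proof -
      have "1 + norm x \<noteq> 0" using norm_ge_zero[of x] by linarith
      then have "(C * D) * (1 + norm x) powi (m + l) = (C * (1 + norm x) powi m) * (D * (1 + norm x) powi l)"
        by (simp add: power_int_add mult_ac)
      moreover have "\<bar>f x * g x\<bar> \<le> \<dots>"
        unfolding abs_mult by (rule mult_mono[OF C(2) D(2)]) (use C(1) in \<open>auto intro: less_imp_le\<close>)
      ultimately show ?thesis by linarith
    qed
    then show ?case by auto
  next
    case (snoc k ks)
    obtain C where C: "\<And>x. \<bar>pd ks (\<lambda>x. f x * partial k g x) x\<bar> \<le> C * (1 + norm x) powi (m + l)"
      using snoc.IH[OF snoc.prems(1) symb_partial[OF snoc.prems(2)]] by blast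
    obtain D where D: "\<And>x. \<bar>pd ks (\<lambda>x. partial k f x * g x) x\<bar> \<le> D * (1 + norm x) powi (m + l)"
      using snoc.IH[OF symb_partial[OF snoc.prems(1)] snoc.prems(2)] by blast
    have sm: "smooth f" "smooth g" using snoc.prems by (auto intro: symb_smooth)
    have "pd (ks @ [k]) (\<lambda>x. f x * g x) = (\<lambda>x. pd ks (\<lambda>x. f x * partial k g x) x + pd ks (\<lambda>x. partial k f x * g x) x)"
      by (simp add: pd_append partial_mult_smooth sm pd_add smooth_mult smooth_partial)
    then have "\<bar>pd (ks @ [k]) (\<lambda>x. f x * g x) x\<bar> \<le> (C + D) * (1 + norm x) powi (m + l)" for x
      using C[of x] D[of x] by (simp add: distrib_right)
    then show ?case by blast
  qed
  moreover assume "symb m f" "symb l g"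
  ultimately show ?thesis by (auto simp: symb_def smooth_mult)
qed

lemma symb_const [simp]: "symb 0 (\<lambda>x. c)"
proof -
  have "\<exists>C. \<forall>x. \<bar>pd ks (\<lambda>x. c) x\<bar> \<le> C" for ks :: "'a list"
    by (cases ks rule: rev_cases) (auto simp: pd_append)
  then show ?thesis by (simp add: symb_def)
qed

lemma symb_component: "symb 1 (\<lambda>x. x $ j)"
proof -
  have "\<exists>C. \<forall>x. \<bar>pd ks (\<lambda>x. x $ j) x\<bar> \<le> C * (1 + norm x)" for ks :: "'a list"
  proof (cases ks rule: rev_cases)
    case Nil
    then show ?thesis
      by (auto intro!: exI[of _ 1] order_trans[OF component_le_norm_cart])
  next
    case (snoc ls k)
    obtain C where C: "C \<ge> 0" "\<And>x. \<bar>pd ls (\<lambda>x. if k = j then 1 else 0) x\<bar> \<le> C"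
      using symb0_pd_bound[OF symb_const] by blast
    have "\<bar>pd ks (\<lambda>x. x $ j) x\<bar> \<le> C * (1 + norm x)" for x
      using C(2)[of x] C(1) mult_left_mono[of 1 "1 + norm x" C]
      by (simp add: snoc pd_append partial_component)
    then show ?thesis by blast
  qed
  then show ?thesis by (simp add: symb_def)
qed

lemma symb_cmult: "symb m f \<Longrightarrow> symb m (\<lambda>x. c * f x)"
  using symb_mult[OF symb_const, of m f] by simp

lemma symb_mult0: "symb 0 f \<Longrightarrow> symb m g \<Longrightarrow> symb m (\<lambda>x. f x * g x)"
  using symb_mult[of 0 f m g] by simp

lemma symb_diff: "symb m f \<Longrightarrow> symb m g \<Longrightarrow> symb m (\<lambda>x. f x - g x)"
  using symb_add[OF _ symb_cmult[of m g "-1"], of f] by simp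

lemma symb_zero [simp]: "symb m (\<lambda>x. 0)"
proof -
  have "\<exists>C. \<forall>x. 0 \<le> C * (1 + norm x) powi m" for x :: "real ^ 'a"
    by (rule exI[of _ 0]) simp
  then show ?thesis by (auto simp: symb_def)
qed

lemma symb_sum: "(\<And>i. i \<in> I \<Longrightarrow> symb m (f i)) \<Longrightarrow> symb m (\<lambda>x. \<Sum>i\<in>I. f i x)"
  by (induction I rule: infinite_finite_induct) (auto intro!: symb_add)

lemma symb_power: "symb m f \<Longrightarrow> symb (int k * m) (\<lambda>x. f x ^ k)"
proof (induction k)
  case (Suc k)
  then show ?case using symb_mult[of m f "int k * m" "\<lambda>x. f x ^ k"] by (simp add: algebra_simps)
qed simp

lemma symb_prod:
  "finite I \<Longrightarrow> (\<And>i. i \<in> I \<Longrightarrow> symb (m i) (f i)) \<Longrightarrow> symb (\<Sum>i\<in>I. m i) (\<lambda>x. \<Prod>i\<in>I. f i x)"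
  by (induction I rule: finite_induct) (auto intro!: symb_mult)

lemma symb_monomial: "symb (int (mi_order \<alpha>)) (monomial \<alpha>)"
proof -
  have "symb (\<Sum>i\<in>UNIV. int (\<alpha> i) * 1) (\<lambda>x. \<Prod>i\<in>UNIV. (x $ i) ^ \<alpha> i)"
    by (intro symb_prod symb_power symb_component) simp
  then show ?thesis by (simp add: mi_order_def monomial_def[abs_def])
qed

text \<open>If coordinate i is the largest in absolute value, then |x| \<le> d |x_i|, hence 1 + |x|
  \<le> (1 + d) max 1 |x_i|. Only pure powers of single coordinates appear on the right, so
  monomials with at most one nonzero exponent suffice to recover the full weight.\<close>

lemma weight_power_le:
  fixes x :: "real ^ 'd::finite"
  shows "(1 + norm x) ^ k \<le> (1 + CARD('d)) ^ k * (1 + (\<Sum>i\<in>UNIV. \<bar>x $ i\<bar> ^ k))"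
proof -
  obtain i where i: "\<And>j. \<bar>x $ j\<bar> \<le> \<bar>x $ i\<bar>"
  proof -
    have "Max (range (\<lambda>j. \<bar>x $ j\<bar>)) \<in> range (\<lambda>j. \<bar>x $ j\<bar>)" by (rule Max_in) auto
    then obtain i where i: "Max (range (\<lambda>j. \<bar>x $ j\<bar>)) = \<bar>x $ i\<bar>" by blast
    have "\<bar>x $ j\<bar> \<le> \<bar>x $ i\<bar>" for j unfolding i[symmetric] by (rule Max_ge) auto
    then show thesis by (rule that)
  qed
  have "norm x \<le> (\<Sum>j\<in>UNIV. \<bar>x $ j\<bar>)" by (rule norm_le_l1_cart)
  also have "\<dots> \<le> of_nat CARD('d) * \<bar>x $ i\<bar>" by (rule sum_bounded_above) (rule i)
  finally have n: "norm x \<le> CARD('d) * \<bar>x $ i\<bar>" .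
  have "1 + norm x \<le> (1 + CARD('d)) * max 1 \<bar>x $ i\<bar>"
    using n mult_left_mono[of "\<bar>x $ i\<bar>" "max 1 \<bar>x $ i\<bar>" "real CARD('d)"]
    unfolding of_nat_add of_nat_1 distrib_right by linarith
  then have "(1 + norm x) ^ k \<le> ((1 + CARD('d)) * max 1 \<bar>x $ i\<bar>) ^ k"
    by (intro power_mono) auto
  also have "\<dots> \<le> (1 + CARD('d)) ^ k * (1 + (\<Sum>i\<in>UNIV. \<bar>x $ i\<bar> ^ k))"
    unfolding power_mult_distrib of_nat_power
  proof (rule mult_left_mono)
    have "\<bar>x $ i\<bar> ^ k \<le> (\<Sum>i\<in>UNIV. \<bar>x $ i\<bar> ^ k)"
      by (rule member_le_sum) auto
    moreover have "0 \<le> (\<Sum>i\<in>UNIV. \<bar>x $ i\<bar> ^ k)" by (simp add: sum_nonneg)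
    ultimately show "max 1 \<bar>x $ i\<bar> ^ k \<le> 1 + (\<Sum>i\<in>UNIV. \<bar>x $ i\<bar> ^ k)"
      by (cases "\<bar>x $ i\<bar> \<le> 1") (auto simp: max_def)
  qed simp
  finally show ?thesis .
qed

lemma monomial_single: "monomial (\<lambda>j. if j = i then k else 0) x = (x $ i) ^ k"
proof -
  have "(\<Prod>j\<in>UNIV. x $ j ^ (if j = i then k else 0)) = (\<Prod>j\<in>UNIV. if j = i then x $ j ^ k else 1)"
    by (rule prod.cong) auto
  then show ?thesis by (simp add: monomial_def)
qed

lemma mi_order_single: "mi_order (\<lambda>j. if j = i then k else 0) = k"
  by (simp add: mi_order_def)

text \<open>Membership in all symbol classes makes closure under sums, products, derivatives and
  multiplication by coefficients immediate. Decay of order k comes from the monomials 1 and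
  x_i^k.\<close>

lemma schwartz_iff_symb: "\<phi> \<in> schwartz \<longleftrightarrow> (\<forall>m. symb m \<phi>)"
proof
  assume \<phi>: "\<phi> \<in> schwartz"
  then have sm: "smooth \<phi>" by (simp add: schwartz_def)
  have mono: "\<exists>C. \<forall>x. \<bar>x $ i ^ k * pd ks \<phi> x\<bar> \<le> C" for i k ks
  proof -
    obtain \<beta> where "pd ks \<phi> = mderiv \<beta> \<phi>"
      using pd_eq_mderiv[of ks] sm by auto
    moreover have "bounded (range (\<lambda>x. monomial (\<lambda>j. if j = i then k else 0) x * mderiv \<beta> \<phi> x))"
      using \<phi> by (simp add: schwartz_def)
    ultimately show ?thesis by (auto simp: bounded_iff monomial_single)
  qed
  have "\<exists>C. \<forall>x. \<bar>pd ks \<phi> x\<bar> \<le> C * (1 + norm x) powi (- int k)" for k ks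
  proof -
    obtain C where C: "\<And>i x. \<bar>x $ i ^ k * pd ks \<phi> x\<bar> \<le> C i"
      using mono[of _ k ks] by metis
    obtain D where D: "\<And>x. \<bar>pd ks \<phi> x\<bar> \<le> D"
      using mono[of _ 0 ks] by auto
    define E where "E = (1 + CARD('a)) ^ k * (D + (\<Sum>i\<in>UNIV. C i))"
    have "\<bar>pd ks \<phi> x\<bar> \<le> E * (1 + norm x) powi (- int k)" for x
    proof -
      have "(1 + norm x) ^ k * \<bar>pd ks \<phi> x\<bar>
          \<le> (1 + CARD('a)) ^ k * (1 + (\<Sum>i\<in>UNIV. \<bar>x $ i\<bar> ^ k)) * \<bar>pd ks \<phi> x\<bar>"
        by (rule mult_right_mono[OF weight_power_le]) simp
      also have "\<dots> = (1 + CARD('a)) ^ k * (\<bar>pd ks \<phi> x\<bar> + (\<Sum>i\<in>UNIV. \<bar>x $ i ^ k * pd ks \<phi> x\<bar>))"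
        by (simp add: distrib_right distrib_left sum_distrib_left sum_distrib_right abs_mult power_abs mult.assoc)
      also have "\<dots> \<le> E"
        unfolding E_def by (intro mult_left_mono add_mono sum_mono C D) simp
      finally show ?thesis
        by (simp add: power_int_minus divide_simps add_pos_nonneg mult.commute)
    qed
    then show ?thesis by blast
  qed
  then have "symb (- int k) \<phi>" for k using sm by (simp add: symb_def)
  \<comment> \<open>The order \<open>- int (nat (- m))\<close> is m for m \<le> 0 and 0 otherwise,
    hence at most m.\<close>
  then have "symb m \<phi>" for m by (rule symb_mono[of "- int (nat (- m))"]) simp
  then show "\<forall>m. symb m \<phi>" by blast
next
  assume s: "\<forall>m. symb m \<phi>"
  have "bounded (range (\<lambda>x. monomial \<alpha> x * mderiv \<beta> \<phi> x))" for \<alpha> \<beta>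
  proof -
    obtain ks where "mderiv \<beta> \<phi> = pd ks \<phi>"
      using mderiv_eq_pd[of \<beta>] by auto
    then have "symb (int (mi_order \<alpha>) + (- int (mi_order \<alpha>))) (\<lambda>x. monomial \<alpha> x * mderiv \<beta> \<phi> x)"
      using s by (intro symb_mult symb_monomial) (simp add: symb_pd)
    then have "symb 0 (\<lambda>x. monomial \<alpha> x * mderiv \<beta> \<phi> x)" by simp
    from symb0_pd_bound[OF this, of "[]"] show ?thesis
      by (auto simp: bounded_iff)
  qed
  then show "\<phi> \<in> schwartz" using s by (auto simp: schwartz_def symb_smooth)
qed

section \<open>Growth of the coefficients\<close>

lemma bounded_derivatives_pd:
  assumes "smooth f" "bounded_derivatives f" "ks \<noteq> []"
  shows "\<exists>C. \<forall>x. \<bar>pd ks f x\<bar> \<le> C"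
proof -
  obtain \<beta> where \<beta>: "mi_order \<beta> = length ks" "\<forall>f. smooth f \<longrightarrow> pd ks f = mderiv \<beta> f"
    using pd_eq_mderiv by blast
  have "length ks \<ge> 1" using assms(3) by (simp add: Suc_leI)
  then have "bounded (range (mderiv \<beta> f))"
    using assms(2) unfolding bounded_derivatives_def \<beta>(1)[symmetric] by blast
  moreover have "mderiv \<beta> f = pd ks f" using assms(1) \<beta>(2) by simp
  ultimately show ?thesis by (simp add: bounded_iff)
qed

lemma symb0_of_bounded:
  assumes "smooth f" "bounded (range f)" "bounded_derivatives f"
  shows "symb 0 f"
proof -
  have "\<exists>C. \<forall>x. \<bar>pd ks f x\<bar> \<le> C" for ks
    using bounded_derivatives_pd[OF assms(1,3)] assms(2) by (cases "ks = []") (auto simp: bounded_iff)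
  then show ?thesis using assms(1) by (simp add: symb_def)
qed

lemma symb0_partial_of_bounded_derivatives:
  assumes "smooth f" "bounded_derivatives f"
  shows "symb 0 (partial i f)"
proof -
  have "\<exists>C. \<forall>x. \<bar>pd ks (partial i f) x\<bar> \<le> C" for ks
    using bounded_derivatives_pd[OF assms, of "ks @ [i]"] by (simp add: pd_append)
  then show ?thesis using assms(1) by (simp add: symb_def smooth_partial)
qed

text \<open>The mean value inequality turns a bounded gradient into linear growth of f. Every
  derivative of f of positive order is a derivative of some bounded partial, and the weight 1 + |x|
  \<ge> 1 only weakens its bound.\<close>

lemma symb1_of_partial:
  assumes sm: "smooth f" and pf: "\<And>i. symb 0 (partial i f)"
  shows "symb 1 f"
proof -
  have "\<exists>C. \<forall>x. \<bar>pd ks f x\<bar> \<le> C * (1 + norm x)" for ks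
  proof (cases ks rule: rev_cases)
    case Nil
    have "\<exists>C\<ge>0. \<forall>x. \<bar>partial i f x\<bar> \<le> C" for i
      using symb0_pd_bound[OF pf[of i], of "[]"] unfolding pd_Nil by blast
    then obtain C where C: "\<And>i. C i \<ge> 0" "\<And>i x. \<bar>partial i f x\<bar> \<le> C i"
      by metis
    \<comment> \<open>Since |v_i| \<le> |v|, the sum of the bounds of the partials dominates the
      operator norm of the derivative at every point.\<close>
    define B where "B = (\<Sum>i\<in>UNIV. C i)"
    have B: "B \<ge> 0" by (simp add: B_def C(1) sum_nonneg)
    have on: "onorm (\<lambda>v. \<Sum>i\<in>UNIV. v $ i * partial i f x) \<le> B" for x
    proof (rule onorm_bound[OF B])
      fix v :: "real ^ 'a"
      have "norm (\<Sum>i\<in>UNIV. v $ i * partial i f x) \<le> (\<Sum>i\<in>UNIV. norm v * C i)"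
        by (rule sum_norm_le)
           (auto simp: abs_mult intro!: mult_mono component_le_norm_cart C)
      also have "\<dots> = B * norm v" unfolding B_def sum_distrib_left[symmetric] by (rule mult.commute)
      finally show "norm (\<Sum>i\<in>UNIV. v $ i * partial i f x) \<le> B * norm v" .
    qed
    have "\<bar>f x\<bar> \<le> (\<bar>f 0\<bar> + B) * (1 + norm x)" for x
    proof -
      have "norm (f x - f 0) \<le> B * norm (x - 0)"
        by (rule differentiable_bound[OF convex_UNIV has_derivative_partial[OF smooth_differentiable[OF sm]] on]) auto
      moreover have "\<bar>f 0\<bar> * norm x \<ge> 0" by simp
      moreover have "(\<bar>f 0\<bar> + B) * (1 + norm x) = \<bar>f 0\<bar> + B + \<bar>f 0\<bar> * norm x + B * norm x"
        by (simp add: algebra_simps)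
      ultimately show ?thesis using B unfolding real_norm_def diff_zero by linarith
    qed
    then show ?thesis by (auto simp: Nil)
  next
    case (snoc ls k)
    obtain C where C: "C \<ge> 0" "\<And>x. \<bar>pd ls (partial k f) x\<bar> \<le> C"
      using symb0_pd_bound[OF pf] by blast
    have "\<bar>pd ks f x\<bar> \<le> C * (1 + norm x)" for x
      using C(2)[of x] C(1) mult_left_mono[of 1 "1 + norm x" C]
      by (simp add: snoc pd_append)
    then show ?thesis by blast
  qed
  then show ?thesis using sm by (simp add: symb_def)
qed

section \<open>Integration by parts\<close>

lemma schwartz_smooth: "\<phi> \<in> schwartz \<Longrightarrow> smooth \<phi>"
  by (simp add: schwartz_def)

lemma symb_times_schwartz: "symb m c \<Longrightarrow> \<phi> \<in> schwartz \<Longrightarrow> (\<lambda>x. c x * \<phi> x) \<in> schwartz"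
  unfolding schwartz_iff_symb
proof
  fix n assume "symb m c" "\<forall>m. symb m \<phi>"
  then have "symb (m + (n - m)) (\<lambda>x. c x * \<phi> x)" by (intro symb_mult) auto
  then show "symb n (\<lambda>x. c x * \<phi> x)" by simp
qed

lemma schwartz_mult: "\<phi> \<in> schwartz \<Longrightarrow> \<psi> \<in> schwartz \<Longrightarrow> (\<lambda>x. \<phi> x * \<psi> x) \<in> schwartz"
  using symb_times_schwartz[of 0 \<phi> \<psi>] by (simp add: schwartz_iff_symb)

lemma schwartz_add: "\<phi> \<in> schwartz \<Longrightarrow> \<psi> \<in> schwartz \<Longrightarrow> (\<lambda>x. \<phi> x + \<psi> x) \<in> schwartz"
  by (simp add: schwartz_iff_symb symb_add)

lemma schwartz_sum:
  "(\<And>i. i \<in> I \<Longrightarrow> \<phi> i \<in> schwartz) \<Longrightarrow> (\<lambda>x. \<Sum>i\<in>I. \<phi> i x) \<in> schwartz"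
  by (simp add: schwartz_iff_symb symb_sum)

lemma schwartz_partial: "\<phi> \<in> schwartz \<Longrightarrow> partial i \<phi> \<in> schwartz"
  by (simp add: schwartz_iff_symb symb_partial)

lemma schwartz_pd: "\<phi> \<in> schwartz \<Longrightarrow> pd ks \<phi> \<in> schwartz"
  by (simp add: schwartz_iff_symb symb_pd)

section \<open>Integrability of Schwartz functions\<close>

lemma integrable_prod_inverse_1_plus_square:
  "integrable lborel (\<lambda>x::'a::euclidean_space. \<Prod>b\<in>Basis. inverse (1 + (x \<bullet> b)\<^sup>2))"
proof -
  interpret product_sigma_finite "\<lambda>_::'a. lborel :: real measure" by standard
  have "integrable lborel (\<lambda>t::real. inverse (1 + t\<^sup>2))"
    using integrable_inverse_1_plus_square by (simp add: set_integrable_def)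
  then have "integrable (\<Pi>\<^sub>M b\<in>(Basis :: 'a set). (lborel :: real measure)) (\<lambda>f. \<Prod>b\<in>Basis. inverse (1 + (f b)\<^sup>2))"
    using product_integrable_prod[of Basis "\<lambda>_ t. inverse (1 + t\<^sup>2)"] by simp
  moreover have "(\<lambda>f. \<Prod>b\<in>Basis. inverse (1 + ((\<Sum>b\<in>Basis. f b *\<^sub>R b) \<bullet> b)\<^sup>2))
    = (\<lambda>f. \<Prod>b\<in>(Basis :: 'a set). inverse (1 + (f b :: real)\<^sup>2))"
    by (intro ext prod.cong) (auto simp: inner_sum_left_Basis)
  ultimately show ?thesis
    by (subst lborel_eq, subst integrable_distr_eq) auto
qed

text \<open>Each factor satisfies 1 + x_b^2 \<le> (1 + |x|)^2, and there are \<open>DIM('a)\<close>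
  of them; this is the exponent. The generous choice costs nothing, since Schwartz functions decay
  at every rate.\<close>

lemma integrable_weight:
  "integrable lborel (\<lambda>x::'a::euclidean_space. (1 + norm x) powi (- int (2 * DIM('a))))"
proof (rule Bochner_Integration.integrable_bound[OF integrable_prod_inverse_1_plus_square])
  show "AE x::'a in lborel. norm ((1 + norm x) powi (- int (2 * DIM('a)))) \<le> norm (\<Prod>b\<in>Basis. inverse (1 + (x \<bullet> b)\<^sup>2))"
  proof (rule AE_I2)
    fix x :: 'a
    have le: "1 + (x \<bullet> b)\<^sup>2 \<le> (1 + norm x)\<^sup>2" if "b \<in> Basis" for b
    proof -
      have "(x \<bullet> b)\<^sup>2 \<le> (norm x)\<^sup>2"
        using Basis_le_norm[OF that, of x] by (simp add: abs_le_square_iff[symmetric])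
      moreover have "(1 + norm x)\<^sup>2 = 1 + (norm x)\<^sup>2 + 2 * norm x" by (simp add: power2_sum)
      ultimately show ?thesis using norm_ge_zero[of x] by linarith
    qed
    have "(\<Prod>b\<in>(Basis :: 'a set). 1 + (x \<bullet> b)\<^sup>2) \<le> (\<Prod>b\<in>(Basis :: 'a set). (1 + norm x)\<^sup>2)"
      by (rule prod_mono) (auto simp: le)
    also have "\<dots> = (1 + norm x) ^ (2 * DIM('a))" by (simp add: power_mult)
    finally have "inverse ((1 + norm x) ^ (2 * DIM('a))) \<le> inverse (\<Prod>b\<in>(Basis :: 'a set). 1 + (x \<bullet> b)\<^sup>2)"
      by (rule le_imp_inverse_le) (auto intro!: prod_pos simp: add_pos_nonneg)
    moreover have "0 \<le> inverse (\<Prod>b\<in>(Basis :: 'a set). 1 + (x \<bullet> b)\<^sup>2)"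
      by (auto intro!: prod_nonneg simp: add_nonneg_nonneg)
    moreover have "0 \<le> inverse ((1 + norm x) ^ (2 * DIM('a)))" by simp
    moreover have "(1 + norm x) powi (- int (2 * DIM('a))) = inverse ((1 + norm x) ^ (2 * DIM('a)))"
      by (simp only: power_int_minus power_int_of_nat)
    moreover have "(\<Prod>b\<in>(Basis :: 'a set). inverse (1 + (x \<bullet> b)\<^sup>2)) = inverse (\<Prod>b\<in>(Basis :: 'a set). 1 + (x \<bullet> b)\<^sup>2)"
      by (rule prod_inversef[unfolded comp_def])
    ultimately show "norm ((1 + norm x) powi (- int (2 * DIM('a)))) \<le> norm (\<Prod>b\<in>Basis. inverse (1 + (x \<bullet> b)\<^sup>2))"
      by simp
  qed
  show "(\<lambda>x::'a. (1 + norm x) powi (- int (2 * DIM('a)))) \<in> borel_measurable lborel"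
    unfolding power_int_minus power_int_of_nat by measurable
qed

lemma smooth_measurable [measurable]: "smooth f \<Longrightarrow> f \<in> borel_measurable lborel"
  using borel_measurable_continuous_onI smooth_continuous by auto

lemma integrable_schwartz: "\<phi> \<in> schwartz \<Longrightarrow> integrable lborel \<phi>"
proof -
  assume \<phi>: "\<phi> \<in> schwartz"
  then have "symb (- int (2 * DIM(real ^ 'a))) \<phi>" by (simp add: schwartz_iff_symb)
  from symb_pd_bound[OF this, of "[]"] obtain C
    where C: "C \<ge> 0" "\<And>x. \<bar>\<phi> x\<bar> \<le> C * (1 + norm x) powi (- int (2 * DIM(real ^ 'a)))"
    unfolding pd_Nil by blast
  show ?thesis
  proof (rule Bochner_Integration.integrable_bound)
    show "integrable lborel (\<lambda>x :: real ^ 'a. C * (1 + norm x) powi (- int (2 * DIM(real ^ 'a))))"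
      by (rule integrable_mult_right[OF integrable_weight])
    show "\<phi> \<in> borel_measurable lborel" by (rule smooth_measurable[OF schwartz_smooth[OF \<phi>]])
    show "AE x in lborel. norm (\<phi> x) \<le> norm (C * (1 + norm x) powi (- int (2 * DIM(real ^ 'a))))"
      by (rule AE_I2) (use C in \<open>simp add: abs_mult less_imp_le\<close>)
  qed
qed

lemma integral_translate:
  fixes f :: "'a::euclidean_space \<Rightarrow> real"
  assumes [measurable]: "f \<in> borel_measurable borel"
  shows "(LINT x|lborel. f (c + x)) = (LINT x|lborel. f x)"
  by (subst (2) lborel_distr_plus[of c, symmetric]) (simp add: integral_distr)

text \<open>The integral of a difference quotient vanishes by translation invariance, and the difference
  quotients converge dominatedly to the partial derivative.\<close>

lemma integral_partial_schwartz:
  fixes \<phi> :: "real ^ 'd::finite \<Rightarrow> real"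
  assumes \<phi>: "\<phi> \<in> schwartz"
  shows "(LINT x|lborel. partial i \<phi> x) = 0"
proof -
  let ?e = "axis i (1::real) :: real ^ 'd" and ?N = "2 * DIM(real ^ 'd)"
  define t where "t n = 1 / real (Suc n)" for n
  have t: "0 < t n" "t n \<le> 1" for n by (auto simp: t_def)
  have sm: "smooth \<phi>" using \<phi> by (rule schwartz_smooth)
  let ?q = "\<lambda>n x. (\<phi> (t n *\<^sub>R ?e + x) - \<phi> x) / t n"
  have "symb (- int ?N) (partial i \<phi>)"
    using schwartz_partial[OF \<phi>] by (simp add: schwartz_iff_symb)
  from symb_pd_bound[OF this, of "[]"] obtain C
    where C: "C \<ge> 0" "\<And>x. \<bar>partial i \<phi> x\<bar> \<le> C * (1 + norm x) powi (- int ?N)"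
    unfolding pd_Nil by blast
  have meas [measurable]: "\<phi> \<in> borel_measurable borel" "partial i \<phi> \<in> borel_measurable borel"
    using smooth_measurable[OF sm] smooth_measurable[OF smooth_partial[OF sm]] by simp_all
  have "(\<lambda>n. LINT x|lborel. ?q n x) \<longlonglongrightarrow> (LINT x|lborel. partial i \<phi> x)"
  proof (rule integral_dominated_convergence)
    show "integrable lborel (\<lambda>x :: real ^ 'd. C * 2 ^ ?N * (1 + norm x) powi (- int ?N))"
      by (rule integrable_mult_right[OF integrable_weight])
    show "AE x in lborel. (\<lambda>n. ?q n x) \<longlonglongrightarrow> partial i \<phi> x"
    proof (rule AE_I2)
      fix x :: "real ^ 'd"
      have "((\<lambda>t. \<phi> (x + t *\<^sub>R ?e)) has_field_derivative partial i \<phi> (x + 0 *\<^sub>R ?e)) (at 0)"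
        by (intro has_field_derivative_partial_line smooth_differentiable sm)
      then have "((\<lambda>h. (\<phi> (x + h *\<^sub>R ?e) - \<phi> x) / h) \<longlongrightarrow> partial i \<phi> x) (at 0)"
        by (simp add: DERIV_def)
      moreover have "filterlim t (at 0) sequentially"
      proof -
        have "t \<longlonglongrightarrow> 0"
          unfolding t_def[abs_def] using LIMSEQ_inverse_real_of_nat by (simp add: inverse_eq_divide)
        then show ?thesis using t(1) by (simp add: filterlim_at less_imp_neq[symmetric])
      qed
      ultimately have "(\<lambda>n. (\<phi> (x + t n *\<^sub>R ?e) - \<phi> x) / t n) \<longlonglongrightarrow> partial i \<phi> x"
        by (rule filterlim_compose)
      then show "(\<lambda>n. ?q n x) \<longlonglongrightarrow> partial i \<phi> x" by (simp add: add.commute)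
    qed
    show "AE x in lborel. norm (?q n x) \<le> C * 2 ^ ?N * (1 + norm x) powi (- int ?N)" for n
    proof (rule AE_I2)
      fix x :: "real ^ 'd"
      have "\<exists>z>0. z < t n \<and> \<phi> (x + t n *\<^sub>R ?e) - \<phi> (x + 0 *\<^sub>R ?e) = (t n - 0) * partial i \<phi> (x + z *\<^sub>R ?e)"
        by (rule MVT2[OF t(1)]) (intro has_field_derivative_partial_line smooth_differentiable sm)
      then obtain z where z: "0 < z" "z < t n" "\<phi> (x + t n *\<^sub>R ?e) - \<phi> x = t n * partial i \<phi> (x + z *\<^sub>R ?e)"
        by auto
      have q: "?q n x = partial i \<phi> (x + z *\<^sub>R ?e)"
        using z(3) t(1)[of n] by (simp add: add.commute)
      \<comment> \<open>The intermediate point is at distance at most 1 from x, so the weights there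
        and at x are comparable up to a factor 2; this is the origin of the power of 2 in the
        dominating function.\<close>
      have "norm x \<le> norm (x + z *\<^sub>R ?e) + 1"
        using norm_triangle_ineq4[of "x + z *\<^sub>R ?e" "z *\<^sub>R ?e"] z t(2)[of n] by simp
      moreover have "a \<le> b + 1 \<Longrightarrow> 0 \<le> b \<Longrightarrow> 1 + a \<le> 2 * (1 + b)" for a b :: real by simp
      ultimately have "1 + norm x \<le> 2 * (1 + norm (x + z *\<^sub>R ?e))" using norm_ge_zero by blast
      then have "(1 + norm x) ^ ?N \<le> (2 * (1 + norm (x + z *\<^sub>R ?e))) ^ ?N"
        by (intro power_mono) auto
      then have "inverse ((1 + norm (x + z *\<^sub>R ?e)) ^ ?N) \<le> 2 ^ ?N * inverse ((1 + norm x) ^ ?N)"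
        unfolding power_mult_distrib by (simp add: divide_simps add_pos_nonneg)
      then have "(1 + norm (x + z *\<^sub>R ?e)) powi (- int ?N) \<le> 2 ^ ?N * (1 + norm x) powi (- int ?N)"
        unfolding power_int_minus power_int_of_nat .
      then have "C * (1 + norm (x + z *\<^sub>R ?e)) powi (- int ?N) \<le> C * 2 ^ ?N * (1 + norm x) powi (- int ?N)"
        using mult_left_mono[OF _ C(1)] by (metis mult.assoc)
      then show "norm (?q n x) \<le> C * 2 ^ ?N * (1 + norm x) powi (- int ?N)"
        using C(2)[of "x + z *\<^sub>R ?e"] unfolding q real_norm_def by (rule order_trans[rotated])
    qed
  qed measurable
  moreover have "(LINT x|lborel. ?q n x) = 0" for n
  proof -
    have int: "integrable lborel \<phi>" by (rule integrable_schwartz[OF \<phi>])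
    then have "integrable lborel (\<lambda>x. \<phi> (t n *\<^sub>R ?e + x))"
      using integrable_distr_eq[of "(+) (t n *\<^sub>R ?e)" lborel borel \<phi>] by (simp add: lborel_distr_plus)
    with int show ?thesis by (simp add: integral_translate)
  qed
  ultimately show ?thesis by (simp only: LIMSEQ_const_iff)
qed

lemma integration_by_parts_partial:
  assumes "\<phi> \<in> schwartz" "\<psi> \<in> schwartz"
  shows "(LINT x|lborel. \<phi> x * partial i \<psi> x) = - (LINT x|lborel. partial i \<phi> x * \<psi> x)"
proof -
  have "0 = (LINT x|lborel. partial i (\<lambda>x. \<phi> x * \<psi> x) x)"
    by (rule integral_partial_schwartz[OF schwartz_mult[OF assms], symmetric])
  also have "\<dots> = (LINT x|lborel. \<phi> x * partial i \<psi> x + partial i \<phi> x * \<psi> x)"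
    by (simp add: partial_mult_smooth schwartz_smooth assms)
  also have "\<dots> = (LINT x|lborel. \<phi> x * partial i \<psi> x) + (LINT x|lborel. partial i \<phi> x * \<psi> x)"
    by (intro Bochner_Integration.integral_add integrable_schwartz schwartz_mult schwartz_partial assms)
  finally show ?thesis by linarith
qed

section \<open>Differential operators with coefficients of polynomial growth\<close>

text \<open>Differential operators of total order at most \<open>n\<close>, a power of \<open>x\<close> counting like a derivative. Only
  the action on the Schwartz space matters.\<close>

inductive opn :: "nat \<Rightarrow> ((real ^ 'd::finite \<Rightarrow> real) \<Rightarrow> real ^ 'd \<Rightarrow> real) \<Rightarrow> bool" for n where
  basic: "symb (int m) c \<Longrightarrow> m + length ks \<le> n \<Longrightarrow>
    (\<And>\<phi>. \<phi> \<in> schwartz \<Longrightarrow> T \<phi> = (\<lambda>x. c x * pd ks \<phi> x)) \<Longrightarrow> opn n T"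
| add: "opn n T \<Longrightarrow> opn n U \<Longrightarrow> (\<And>\<phi>. \<phi> \<in> schwartz \<Longrightarrow> V \<phi> = (\<lambda>x. T \<phi> x + U \<phi> x)) \<Longrightarrow> opn n V"

lemma opn_zero: "opn n (\<lambda>\<phi> x. 0)"
  by (rule opn.basic[of 0 "\<lambda>x. 0" "[]"]) auto

lemma opn_cong: "opn n T \<Longrightarrow> (\<And>\<phi>. \<phi> \<in> schwartz \<Longrightarrow> U \<phi> = T \<phi>) \<Longrightarrow> opn n U"
  by (rule opn.add[OF _ opn_zero]) auto

lemma opn_add: "opn n T \<Longrightarrow> opn n U \<Longrightarrow> opn n (\<lambda>\<phi> x. T \<phi> x + U \<phi> x)"
  by (rule opn.add) auto

lemma opn_mono: "opn n T \<Longrightarrow> n \<le> n' \<Longrightarrow> opn n' T"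
proof (induction rule: opn.induct)
  case (basic m c ks T)
  show ?case by (rule opn.basic[OF basic(1) _ basic(3)]) (use basic in auto)
next
  case (add T U V)
  show ?case by (rule opn.add[of _ T U]) (use add in auto)
qed

lemma opn_schwartz: "opn n T \<Longrightarrow> \<phi> \<in> schwartz \<Longrightarrow> T \<phi> \<in> schwartz"
proof (induction rule: opn.induct)
  case (basic m c ks T)
  then show ?case by (simp add: symb_times_schwartz schwartz_pd)
next
  case (add T U V)
  then show ?case by (simp add: schwartz_add)
qed

lemma opn_mult: "opn n T \<Longrightarrow> symb (int m) c \<Longrightarrow> opn (m + n) (\<lambda>\<phi> x. c x * T \<phi> x)"
proof (induction rule: opn.induct)
  case (basic l b ks T)
  have "symb (int (m + l)) (\<lambda>x. c x * b x)" using symb_mult[OF basic(4,1)] by simp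
  then show ?case by (rule opn.basic[where ks = ks]) (use basic in \<open>auto simp: mult.assoc\<close>)
next
  case (add T U V)
  show ?case by (rule opn.add[OF add(4,5)]) (use add in \<open>auto simp: distrib_left\<close>)
qed

lemma opn_mult0: "opn n T \<Longrightarrow> symb 0 c \<Longrightarrow> opn n (\<lambda>\<phi> x. c x * T \<phi> x)"
  using opn_mult[of n T 0 c] by simp

lemma opn_cmult: "opn n T \<Longrightarrow> opn n (\<lambda>\<phi> x. c * T \<phi> x)"
  using opn_mult0[OF _ symb_const] .

lemma opn_diff: "opn n T \<Longrightarrow> opn n U \<Longrightarrow> opn n (\<lambda>\<phi> x. T \<phi> x - U \<phi> x)"
  by (rule opn.add[OF _ opn_cmult[of n U "- 1"]]) auto

lemma opn_sum: "(\<And>i. i \<in> I \<Longrightarrow> opn n (T i)) \<Longrightarrow> opn n (\<lambda>\<phi> x. \<Sum>i\<in>I. T i \<phi> x)"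
  by (induction I rule: infinite_finite_induct) (auto intro: opn_zero opn_add)

lemma partial_add_smooth:
  "smooth f \<Longrightarrow> smooth g \<Longrightarrow> partial i (\<lambda>x. f x + g x) = (\<lambda>x. partial i f x + partial i g x)"
  using pd_add[of f g "[i]"] by simp

lemma partial_cmult_smooth: "smooth f \<Longrightarrow> partial i (\<lambda>x. c * f x) = (\<lambda>x. c * partial i f x)"
  by (simp add: partial_mult_smooth)

lemma partial_diff_smooth:
  "smooth f \<Longrightarrow> smooth g \<Longrightarrow> partial i (\<lambda>x. f x - g x) = (\<lambda>x. partial i f x - partial i g x)"
  using partial_add_smooth[of f "\<lambda>x. - 1 * g x" i] partial_cmult_smooth[of g i "- 1"]
  by (simp add: smooth_mult[of "\<lambda>x. - 1" g, simplified])

lemma opn_partial: "opn n T \<Longrightarrow> opn (Suc n) (\<lambda>\<phi>. partial k (T \<phi>))"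
proof (induction rule: opn.induct)
  case (basic m c ks T)
  show ?case
  proof (rule opn.add)
    show "opn (Suc n) (\<lambda>\<phi> x. c x * pd (k # ks) \<phi> x)"
      by (rule opn.basic[OF basic(1) _ refl]) (use basic(2) in simp)
    show "opn (Suc n) (\<lambda>\<phi> x. partial k c x * pd ks \<phi> x)"
      by (rule opn.basic[OF symb_partial[OF basic(1)] _ refl]) (use basic(2) in simp)
    show "partial k (T \<phi>) = (\<lambda>x. c x * pd (k # ks) \<phi> x + partial k c x * pd ks \<phi> x)"
      if "\<phi> \<in> schwartz" for \<phi>
      using basic that by (simp add: partial_mult_smooth symb_smooth[OF basic(1)] schwartz_smooth smooth_pd)
  qed
next
  case (add T U V)
  show ?case
    by (rule opn.add[OF add(4,5)])
       (use add in \<open>auto simp: partial_add_smooth schwartz_smooth opn_schwartz\<close>)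
qed

lemma opn_pd: "opn n T \<Longrightarrow> opn (length ks + n) (\<lambda>\<phi>. pd ks (T \<phi>))"
  by (induction ks) (auto intro: opn_partial)

lemma opn_comp:
  assumes "opn n T" "opn m U"
  shows "opn (n + m) (\<lambda>\<phi>. T (U \<phi>))"
  using assms(1)
proof (induction rule: opn.induct)
  case (basic l c ks T)
  have "opn (l + (length ks + m)) (\<lambda>\<phi> x. c x * pd ks (U \<phi>) x)"
    by (rule opn_mult[OF opn_pd[OF assms(2)] basic(1)])
  then have "opn (n + m) (\<lambda>\<phi> x. c x * pd ks (U \<phi>) x)"
    by (rule opn_mono) (use basic in simp)
  then show ?case
    by (rule opn_cong) (use basic opn_schwartz[OF assms(2)] in simp)
next
  case (add T T' V)
  show ?case
    by (rule opn.add[OF add(4,5)]) (use add opn_schwartz[OF assms(2)] in simp)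
qed

lemma opn_id: "opn n (\<lambda>\<phi>. \<phi>)"
  by (rule opn.basic[of 0 "\<lambda>x. 1" "[]"]) auto

lemma opn_mult_id: "symb 0 c \<Longrightarrow> opn n (\<lambda>\<phi> x. c x * \<phi> x)"
  by (rule opn_mult0[OF opn_id])

lemma opn_partial_id: "opn (Suc n) (partial k)"
  by (rule opn_partial[OF opn_id])

text \<open>Members of \<open>opn\<close> are bare maps on functions. Linearity on the Schwartz
  space is recovered from their normal form; it lets them pass through the sums that make up L and
  A.\<close>

lemma opn_additive:
  "opn n T \<Longrightarrow> \<phi> \<in> schwartz \<Longrightarrow> \<psi> \<in> schwartz \<Longrightarrow> T (\<lambda>x. \<phi> x + \<psi> x) = (\<lambda>x. T \<phi> x + T \<psi> x)"
proof (induction rule: opn.induct)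
  case (basic m c ks T)
  then show ?case by (simp add: schwartz_add pd_add schwartz_smooth distrib_left)
next
  case (add T U V)
  then show ?case by (simp add: schwartz_add add_ac)
qed

lemma opn_apply_cmult: "opn n T \<Longrightarrow> \<phi> \<in> schwartz \<Longrightarrow> T (\<lambda>x. a * \<phi> x) = (\<lambda>x. a * T \<phi> x)"
proof (induction rule: opn.induct)
  case (basic m c ks T)
  have "pd ks (\<lambda>x. a * \<phi> x) = (\<lambda>x. a * pd ks \<phi> x)"
    by (induction ks) (auto simp: partial_cmult_smooth smooth_pd schwartz_smooth[OF basic(4)])
  then show ?case using basic by (simp add: symb_times_schwartz[OF symb_const] mult.left_commute)
next
  case (add T U V)
  then show ?case by (simp add: symb_times_schwartz[OF symb_const] distrib_left)
qed

lemma opn_apply_zero: "opn n T \<Longrightarrow> T (\<lambda>x. 0) = (\<lambda>x. 0)"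
proof (induction rule: opn.induct)
  case (basic m c ks T)
  then show ?case by (simp add: schwartz_iff_symb)
next
  case (add T U V)
  then show ?case by (simp add: schwartz_iff_symb)
qed

lemma opn_apply_sum:
  "opn n T \<Longrightarrow> (\<And>i. i \<in> I \<Longrightarrow> \<phi> i \<in> schwartz) \<Longrightarrow>
    T (\<lambda>x. \<Sum>i\<in>I. \<phi> i x) = (\<lambda>x. \<Sum>i\<in>I. T (\<phi> i) x)"
proof (induction I rule: infinite_finite_induct)
  case (insert i I)
  have "T (\<lambda>x. \<phi> i x + (\<Sum>i\<in>I. \<phi> i x)) = (\<lambda>x. T (\<phi> i) x + T (\<lambda>x. \<Sum>i\<in>I. \<phi> i x) x)"
    by (rule opn_additive[OF insert.prems(1)]) (auto intro!: schwartz_sum insert.prems)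
  then show ?case using insert by simp
qed (auto simp: opn_apply_zero)

text \<open>With P the derivative along the shorter list, [\<partial>_k P, F] = \<partial>_k [P, F]
  + (\<partial>_k F) P. Only derivatives of F occur, so F itself may grow. The nonempty list
  \<open>k # ks\<close> expresses that the commutator has one order less than the
  derivative.\<close>

lemma opn_commutator_mult_pd:
  assumes F: "\<And>k. symb 0 (partial k F)" "smooth F"
  shows "opn (length ks) (\<lambda>\<phi> x. pd (k # ks) (\<lambda>x. F x * \<phi> x) x - F x * pd (k # ks) \<phi> x)"
proof (induction ks arbitrary: k)
  case Nil
  show ?case
    by (rule opn.basic[of 0 "partial k F" "[]"])
       (auto simp: F partial_mult_smooth schwartz_smooth)
next
  case (Cons l ks)
  let ?U = "\<lambda>\<phi> x. pd (l # ks) (\<lambda>x. F x * \<phi> x) x - F x * pd (l # ks) \<phi> x"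
  show ?case
  proof (rule opn.add)
    show "opn (length (l # ks)) (\<lambda>\<phi>. partial k (?U \<phi>))"
      using opn_partial[OF Cons] by simp
    show "opn (length (l # ks)) (\<lambda>\<phi> x. partial k F x * pd (l # ks) \<phi> x)"
      by (rule opn.basic[of 0, OF _ _ refl]) (auto simp: F)
    show "(\<lambda>x. pd (k # l # ks) (\<lambda>x. F x * \<phi> x) x - F x * pd (k # l # ks) \<phi> x)
      = (\<lambda>x. partial k (?U \<phi>) x + partial k F x * pd (l # ks) \<phi> x)" if "\<phi> \<in> schwartz" for \<phi>
    proof -
      have "smooth (pd (l # ks) (\<lambda>x. F x * \<phi> x))" "smooth (pd (l # ks) \<phi>)"
        using that F(2) by (simp_all only: smooth_pd smooth_mult schwartz_smooth)
      then show ?thesis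
        unfolding pd_Cons[of k] by (simp add: partial_diff_smooth partial_mult_smooth smooth_mult F(2) del: pd_Cons)
    qed
  qed
qed

text \<open>Linear growth of \<open>F\<close> is harmless here: it is either differentiated or paid for by a derivative
  of the coefficient \<open>c\<close>.\<close>

lemma opn_commutator_partial_basic:
  assumes F: "\<And>k. symb 0 (partial k F)" "smooth F"
    and c: "symb (int m) c" "m + length ks \<le> n" "symb (int m) (\<lambda>x. F x * partial j c x)"
  shows "opn n (\<lambda>\<phi> x. c x * pd ks (\<lambda>x. F x * partial j \<phi> x) x - F x * partial j (\<lambda>x. c x * pd ks \<phi> x) x)"
proof -
  \<comment> \<open>With P = \<open>pd ks\<close> the operator is c [P, F] \<partial>_j - F
    (\<partial>_j c) P. The order lost in [P, F] is restored by \<partial>_j, and the assumption on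
    F \<partial>_j c takes care of the second term.\<close>
  let ?K = "\<lambda>\<phi> x. pd ks (\<lambda>x. F x * partial j \<phi> x) x - F x * pd ks (partial j \<phi>) x"
  have "opn (length ks) ?K"
  proof (cases ks)
    case (Cons l ls)
    show ?thesis
      using opn_comp[OF opn_commutator_mult_pd[OF F] opn_partial_id[of 0]] by (simp add: Cons)
  qed (simp add: opn_zero)
  then have "opn n (\<lambda>\<phi> x. c x * ?K \<phi> x)"
    by (rule opn_mono[OF opn_mult[OF _ c(1)] c(2)])
  moreover have "opn n (\<lambda>\<phi> x. (F x * partial j c x) * pd ks \<phi> x)"
    by (rule opn.basic[OF c(3,2) refl])
  ultimately show ?thesis
  proof (rule opn_cong[OF opn_diff])
    fix \<phi> :: "real ^ 'a \<Rightarrow> real" assume "\<phi> \<in> schwartz"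
    then have "smooth \<phi>" by (rule schwartz_smooth)
    then show "(\<lambda>x. c x * pd ks (\<lambda>x. F x * partial j \<phi> x) x - F x * partial j (\<lambda>x. c x * pd ks \<phi> x) x)
      = (\<lambda>x. c x * ?K \<phi> x - F x * partial j c x * pd ks \<phi> x)"
      by (simp add: partial_mult_smooth symb_smooth[OF c(1)] smooth_pd pd_partial_commute algebra_simps)
  qed
qed

text \<open>The commutator loses one order, so a further \<partial>_j is affordable. Stating both
  bounds expresses this without an order n - 1, which is meaningless for n = 0; for an empty list
  the commutator vanishes.\<close>

lemma opn_commutator_mult_basic:
  assumes h: "symb 0 h" and c: "symb (int m) c" "m + length ks \<le> n"
  shows "opn n (\<lambda>\<phi> x. c x * pd ks (\<lambda>x. h x * \<phi> x) x - h x * (c x * pd ks \<phi> x))" (is "opn n ?K")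
    and "opn n (\<lambda>\<phi>. partial j (\<lambda>x. c x * pd ks (\<lambda>x. h x * \<phi> x) x - h x * (c x * pd ks \<phi> x)))"
proof -
  have "opn n ?K \<and> opn n (\<lambda>\<phi>. partial j (?K \<phi>))"
  proof (cases ks)
    case Nil
    show ?thesis by (simp add: Nil mult.left_commute opn_zero)
  next
    case (Cons l ls)
    have "opn (length ls) (\<lambda>\<phi> x. pd ks (\<lambda>x. h x * \<phi> x) x - h x * pd ks \<phi> x)"
      unfolding Cons by (rule opn_commutator_mult_pd[OF symb_partial[OF h] symb_smooth[OF h]])
    from opn_mult[OF this c(1)] have "opn (m + length ls) ?K"
      by (rule opn_cong) (simp add: algebra_simps)
    moreover from opn_partial[OF this, of j] have "opn n (\<lambda>\<phi>. partial j (?K \<phi>))"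
      by (rule opn_mono) (use c(2) Cons in simp)
    ultimately show ?thesis using c(2) Cons by (auto elim: opn_mono)
  qed
  then show "opn n ?K" "opn n (\<lambda>\<phi>. partial j (?K \<phi>))" by auto
qed

text \<open>For bounded f the product f \<partial>_j c stays in the class of c, so every operator of
  order n is admissible. The commutator is again of this kind, which permits taking it
  twice.\<close>

lemma opn_commutator_partial:
  assumes "opn n T" and f: "symb 0 f"
  shows "opn n (\<lambda>\<phi> x. T (\<lambda>x. f x * partial j \<phi> x) x - f x * partial j (T \<phi>) x)"
  using assms(1)
proof (induction rule: opn.induct)
  case (basic m c ks T)
  have "opn n (\<lambda>\<phi> x. c x * pd ks (\<lambda>x. f x * partial j \<phi> x) x - f x * partial j (\<lambda>x. c x * pd ks \<phi> x) x)"
    using f basic(1,2)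
    by (intro opn_commutator_partial_basic symb_mult0) (auto intro: symb_partial symb_smooth)
  then show ?case
    by (rule opn_cong) (simp add: basic(3) symb_times_schwartz[OF f] schwartz_partial)
next
  case (add T U V)
  show ?case
    by (rule opn.add[OF add(4,5)])
       (simp add: add(3) symb_times_schwartz[OF f] schwartz_partial partial_add_smooth
          schwartz_smooth opn_schwartz[OF add(1)] opn_schwartz[OF add(2)] algebra_simps)
qed

definition vfield :: "('d::finite \<Rightarrow> real ^ 'd \<Rightarrow> real) \<Rightarrow> (real ^ 'd \<Rightarrow> real) \<Rightarrow> real ^ 'd \<Rightarrow> real" where
  "vfield b \<phi> x = (\<Sum>j\<in>UNIV. b j x * partial j \<phi> x)"

lemma opn_vfield: "(\<And>j. symb 0 (b j)) \<Longrightarrow> opn (Suc 0) (vfield b)"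
  unfolding vfield_def[abs_def] by (intro opn_sum opn_mult0 opn_partial_id)

lemma opn_commutator_vfield:
  assumes T: "opn n T" and b: "\<And>j. symb 0 (b j)"
  shows "opn n (\<lambda>\<phi> x. T (vfield b \<phi>) x - vfield b (T \<phi>) x)"
proof -
  have "opn n (\<lambda>\<phi> x. \<Sum>j\<in>UNIV. T (\<lambda>x. b j x * partial j \<phi> x) x - b j x * partial j (T \<phi>) x)"
    by (intro opn_sum opn_commutator_partial T b)
  then show ?thesis
  proof (rule opn_cong)
    fix \<phi> :: "real ^ 'a \<Rightarrow> real" assume "\<phi> \<in> schwartz"
    then have "T (vfield b \<phi>) = (\<lambda>x. \<Sum>j\<in>UNIV. T (\<lambda>x. b j x * partial j \<phi> x) x)"
      unfolding vfield_def[abs_def]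
      by (intro opn_apply_sum[OF T] symb_times_schwartz[OF b] schwartz_partial)
    then show "(\<lambda>x. T (vfield b \<phi>) x - vfield b (T \<phi>) x)
      = (\<lambda>x. \<Sum>j\<in>UNIV. T (\<lambda>x. b j x * partial j \<phi> x) x - b j x * partial j (T \<phi>) x)"
      by (simp add: vfield_def sum_subtractf)
  qed
qed

section \<open>Forms controlled by the Sobolev norm\<close>

lemma square_monomial_mderiv_le_inner_p:
  assumes "\<phi> \<in> schwartz" "mi_order \<alpha> + mi_order \<beta> \<le> 2 * p"
  shows "(LINT x|lborel. (monomial \<alpha> x * mderiv \<beta> \<phi> x)\<^sup>2) \<le> inner_p p \<phi> \<phi>"
proof -
  have "(\<lambda>(\<alpha>, \<beta>). LINT x|lborel. (monomial \<alpha> x * mderiv \<beta> \<phi> x) * (monomial \<alpha> x * mderiv \<beta> \<phi> x)) (\<alpha>, \<beta>)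
    \<le> inner_p p \<phi> \<phi>"
    unfolding inner_p_def
    by (rule member_le_sum) (use assms(2) finite_mi_order_le in \<open>auto\<close>)
  then show ?thesis by (simp add: power2_eq_square)
qed

lemma inner_p_nonneg: "0 \<le> inner_p p \<phi> \<phi>"
  unfolding inner_p_def by (rule sum_nonneg) auto

lemma norm_p_square: "(norm_p p \<phi>)\<^sup>2 = inner_p p \<phi> \<phi>"
  by (simp add: norm_p_def inner_p_nonneg)

lemma integrable_schwartz_square: "\<phi> \<in> schwartz \<Longrightarrow> integrable lborel (\<lambda>x. (\<phi> x)\<^sup>2)"
  unfolding power2_eq_square by (intro integrable_schwartz schwartz_mult)

text \<open>Here the norm is seen to control every operator of order at most 2 p. The square of a
  coefficient of growth m is bounded by a multiple of 1 + (sum of x_i^(2 m)). Together with a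
  derivative of order |\<beta>| these are squares of x^\<alpha> \<partial>^\<beta> \<phi> with
  |\<alpha>| = 0 or |\<alpha>| = m, all of which occur in \<open>inner_p\<close> because m +
  |\<beta>| \<le> 2 p.\<close>

lemma opn_norm_bound:
  assumes "opn (2 * p) T"
  shows "\<exists>C. \<forall>\<phi>\<in>schwartz. (LINT x|lborel. (T \<phi> x)\<^sup>2) \<le> C * inner_p p \<phi> \<phi>"
  using assms
proof (induction rule: opn.induct)
  case (basic m c ks T)
  from symb_pd_bound[OF basic(1), of "[]"] obtain B
    where B: "B \<ge> 0" "\<And>x. \<bar>c x\<bar> \<le> B * (1 + norm x) ^ m"
    by (auto simp: power_int_of_nat)
  obtain \<beta> where \<beta>: "mi_order \<beta> = length ks" "\<And>f. smooth f \<Longrightarrow> pd ks f = mderiv \<beta> f"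
    using pd_eq_mderiv by blast
  define E :: "'a \<Rightarrow> nat \<Rightarrow> 'a \<Rightarrow> nat" where "E i k = (\<lambda>j. if j = i then k else 0)" for i k
  define K where "K = B\<^sup>2 * (1 + CARD('a)) ^ (2 * m)"
  show ?case
  proof (intro exI ballI)
    fix \<phi> :: "real ^ 'a \<Rightarrow> real" assume \<phi>: "\<phi> \<in> schwartz"
    let ?u = "mderiv \<beta> \<phi>"
    have u: "?u \<in> schwartz" using \<beta>(2) \<phi> schwartz_pd schwartz_smooth by metis
    have Tu: "T \<phi> = (\<lambda>x. c x * ?u x)" using basic(3)[OF \<phi>] \<beta>(2)[OF schwartz_smooth[OF \<phi>]] by simp
    have Mu: "(\<lambda>x. monomial \<alpha> x * ?u x) \<in> schwartz" for \<alpha>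
      by (rule symb_times_schwartz[OF symb_monomial u])
    have m0: "monomial (\<lambda>_. 0) = (\<lambda>x :: real ^ 'a. 1)" by (simp add: monomial_def[abs_def])
    have pw: "(T \<phi> x)\<^sup>2 \<le> K * ((monomial (\<lambda>_. 0) x * ?u x)\<^sup>2 + (\<Sum>i\<in>UNIV. (monomial (E i m) x * ?u x)\<^sup>2))" for x
    proof -
      have "(c x)\<^sup>2 \<le> (B * (1 + norm x) ^ m)\<^sup>2"
        unfolding abs_le_square_iff[symmetric] by (rule order_trans[OF B(2) abs_ge_self])
      also have "\<dots> = B\<^sup>2 * (1 + norm x) ^ (2 * m)"
        by (simp add: power_mult_distrib power_mult[symmetric] mult.commute)
      also have "\<dots> \<le> B\<^sup>2 * ((1 + CARD('a)) ^ (2 * m) * (1 + (\<Sum>i\<in>UNIV. \<bar>x $ i\<bar> ^ (2 * m))))"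
        by (rule mult_left_mono[OF weight_power_le]) simp
      also have "\<dots> = K * (1 + (\<Sum>i\<in>UNIV. (monomial (E i m) x)\<^sup>2))"
      proof -
        have "\<bar>x $ i\<bar> ^ (2 * m) = (monomial (E i m) x)\<^sup>2" for i
          unfolding E_def monomial_single power_mult[symmetric] mult.commute[of m 2] by (simp add: power_even_abs)
        then show ?thesis by (simp add: K_def mult.assoc)
      qed
      finally have "(c x)\<^sup>2 * (?u x)\<^sup>2 \<le> K * (1 + (\<Sum>i\<in>UNIV. (monomial (E i m) x)\<^sup>2)) * (?u x)\<^sup>2"
        by (rule mult_right_mono) simp
      then show ?thesis
        by (simp add: Tu m0 power_mult_distrib distrib_right distrib_left sum_distrib_right sum_distrib_left mult.assoc)
    qed
    have le: "(LINT x|lborel. (monomial \<alpha> x * ?u x)\<^sup>2) \<le> inner_p p \<phi> \<phi>" if "mi_order \<alpha> \<le> m" for \<alpha>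
      by (rule square_monomial_mderiv_le_inner_p[OF \<phi>]) (use that \<beta>(1) basic(2) in simp)
    have "(LINT x|lborel. (T \<phi> x)\<^sup>2)
      \<le> (LINT x|lborel. K * ((monomial (\<lambda>_. 0) x * ?u x)\<^sup>2 + (\<Sum>i\<in>UNIV. (monomial (E i m) x * ?u x)\<^sup>2)))"
    proof (rule integral_mono[OF _ _ pw])
      show "integrable lborel (\<lambda>x. (T \<phi> x)\<^sup>2)"
        unfolding Tu by (intro integrable_schwartz_square symb_times_schwartz[OF basic(1) u])
    qed (intro integrable_mult_right Bochner_Integration.integrable_add Bochner_Integration.integrable_sum
          integrable_schwartz_square Mu)
    also have "\<dots> = K * ((LINT x|lborel. (monomial (\<lambda>_. 0) x * ?u x)\<^sup>2)
        + (\<Sum>i\<in>UNIV. LINT x|lborel. (monomial (E i m) x * ?u x)\<^sup>2))"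
      using integrable_schwartz_square[OF Mu]
      by (simp add: Bochner_Integration.integral_add Bochner_Integration.integral_sum)
    also have "\<dots> \<le> K * (inner_p p \<phi> \<phi> + (\<Sum>i\<in>(UNIV :: 'a set). inner_p p \<phi> \<phi>))"
      by (intro mult_left_mono add_mono sum_mono le)
         (auto simp: K_def E_def mi_order_single, simp add: mi_order_def)
    finally show "(LINT x|lborel. (T \<phi> x)\<^sup>2) \<le> (K * (1 + CARD('a))) * inner_p p \<phi> \<phi>"
      by (simp add: algebra_simps)
  qed
next
  case (add T U V)
  obtain C where C: "\<And>\<phi>. \<phi> \<in> schwartz \<Longrightarrow> (LINT x|lborel. (T \<phi> x)\<^sup>2) \<le> C * inner_p p \<phi> \<phi>"
    using add(4) by blast
  obtain D where D: "\<And>\<phi>. \<phi> \<in> schwartz \<Longrightarrow> (LINT x|lborel. (U \<phi> x)\<^sup>2) \<le> D * inner_p p \<phi> \<phi>"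
    using add(5) by blast
  show ?case
  proof (intro exI ballI)
    fix \<phi> :: "real ^ 'a \<Rightarrow> real" assume \<phi>: "\<phi> \<in> schwartz"
    note T = integrable_schwartz_square[OF opn_schwartz[OF add(1) \<phi>]]
      and U = integrable_schwartz_square[OF opn_schwartz[OF add(2) \<phi>]]
      and V = integrable_schwartz_square[OF schwartz_add[OF opn_schwartz[OF add(1) \<phi>] opn_schwartz[OF add(2) \<phi>]]]
    have "(LINT x|lborel. (V \<phi> x)\<^sup>2) \<le> (LINT x|lborel. 2 * (T \<phi> x)\<^sup>2 + 2 * (U \<phi> x)\<^sup>2)"
    proof (rule integral_mono)
      \<comment> \<open>The difference of the two sides is the square of T \<phi> - U
        \<phi>.\<close>
      show "(V \<phi> x)\<^sup>2 \<le> 2 * (T \<phi> x)\<^sup>2 + 2 * (U \<phi> x)\<^sup>2" for x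
        using sum_squares_ge_zero[of "T \<phi> x - U \<phi> x" 0]
        by (simp add: add(3)[OF \<phi>] power2_eq_square algebra_simps)
    qed (use T U V add(3)[OF \<phi>] in auto)
    also have "\<dots> = 2 * (LINT x|lborel. (T \<phi> x)\<^sup>2) + 2 * (LINT x|lborel. (U \<phi> x)\<^sup>2)"
      using T U by simp
    also have "\<dots> \<le> (2 * C + 2 * D) * inner_p p \<phi> \<phi>"
      using C[OF \<phi>] D[OF \<phi>] by (simp add: algebra_simps)
    finally show "(LINT x|lborel. (V \<phi> x)\<^sup>2) \<le> (2 * C + 2 * D) * inner_p p \<phi> \<phi>" .
  qed
qed

text \<open>The absolute value makes the notion stable under differences, so an energy identity can
  be estimated term by term whatever the signs.\<close>

definition controlled :: "nat \<Rightarrow> ((real ^ 'd::finite \<Rightarrow> real) \<Rightarrow> real) \<Rightarrow> bool" where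
  "controlled p B \<longleftrightarrow> (\<exists>C. \<forall>\<phi>\<in>schwartz. \<bar>B \<phi>\<bar> \<le> C * inner_p p \<phi> \<phi>)"

lemma controlled_cong: "controlled p B \<Longrightarrow> (\<And>\<phi>. \<phi> \<in> schwartz \<Longrightarrow> B' \<phi> = B \<phi>) \<Longrightarrow> controlled p B'"
  by (simp add: controlled_def)

lemma controlled_zero: "controlled p (\<lambda>\<phi>. 0)"
  unfolding controlled_def by (rule exI[of _ 0]) simp

lemma controlled_add: "controlled p B \<Longrightarrow> controlled p B' \<Longrightarrow> controlled p (\<lambda>\<phi>. B \<phi> + B' \<phi>)"
proof -
  assume "controlled p B" "controlled p B'"
  then obtain C C' where "\<And>\<phi>. \<phi> \<in> schwartz \<Longrightarrow> \<bar>B \<phi>\<bar> \<le> C * inner_p p \<phi> \<phi>"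
    "\<And>\<phi>. \<phi> \<in> schwartz \<Longrightarrow> \<bar>B' \<phi>\<bar> \<le> C' * inner_p p \<phi> \<phi>"
    unfolding controlled_def by blast
  then have "\<bar>B \<phi> + B' \<phi>\<bar> \<le> (C + C') * inner_p p \<phi> \<phi>" if "\<phi> \<in> schwartz" for \<phi>
    unfolding distrib_right using that by (intro order_trans[OF abs_triangle_ineq] add_mono) auto
  then show ?thesis unfolding controlled_def by blast
qed

lemma controlled_cmult: "controlled p B \<Longrightarrow> controlled p (\<lambda>\<phi>. a * B \<phi>)"
proof -
  assume "controlled p B"
  then obtain C where C: "\<And>\<phi>. \<phi> \<in> schwartz \<Longrightarrow> \<bar>B \<phi>\<bar> \<le> C * inner_p p \<phi> \<phi>"
    unfolding controlled_def by blast
  have "\<bar>a * B \<phi>\<bar> \<le> (\<bar>a\<bar> * C) * inner_p p \<phi> \<phi>" if "\<phi> \<in> schwartz" for \<phi>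
    using mult_left_mono[OF C[OF that], of "\<bar>a\<bar>"] by (simp add: abs_mult mult.assoc)
  then show ?thesis unfolding controlled_def by blast
qed

lemma controlled_diff: "controlled p B \<Longrightarrow> controlled p B' \<Longrightarrow> controlled p (\<lambda>\<phi>. B \<phi> - B' \<phi>)"
  using controlled_add[OF _ controlled_cmult[of p B' "- 1"], of B] by simp

lemma controlled_sum: "(\<And>i. i \<in> I \<Longrightarrow> controlled p (B i)) \<Longrightarrow> controlled p (\<lambda>\<phi>. \<Sum>i\<in>I. B i \<phi>)"
  by (induction I rule: infinite_finite_induct) (auto intro: controlled_zero controlled_add)

text \<open>The pointwise bound |a b| \<le> a^2 + b^2 does the work of the Cauchy-Schwarz
  inequality, because both squares are measured by the same \<open>inner_p\<close>.\<close>

lemma controlled_inner: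
  assumes T: "opn (2 * p) T" and U: "opn (2 * p) U"
  shows "controlled p (\<lambda>\<phi>. LINT x|lborel. T \<phi> x * U \<phi> x)"
proof -
  obtain C where C: "\<And>\<phi>. \<phi> \<in> schwartz \<Longrightarrow> (LINT x|lborel. (T \<phi> x)\<^sup>2) \<le> C * inner_p p \<phi> \<phi>"
    using opn_norm_bound[OF T] by blast
  obtain D where D: "\<And>\<phi>. \<phi> \<in> schwartz \<Longrightarrow> (LINT x|lborel. (U \<phi> x)\<^sup>2) \<le> D * inner_p p \<phi> \<phi>"
    using opn_norm_bound[OF U] by blast
  have "\<bar>LINT x|lborel. T \<phi> x * U \<phi> x\<bar> \<le> (C + D) * inner_p p \<phi> \<phi>" if \<phi>: "\<phi> \<in> schwartz" for \<phi>
  proof -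
    note i = integrable_schwartz_square[OF opn_schwartz[OF T \<phi>]]
      integrable_schwartz_square[OF opn_schwartz[OF U \<phi>]]
    have "\<bar>LINT x|lborel. T \<phi> x * U \<phi> x\<bar> \<le> (LINT x|lborel. (T \<phi> x)\<^sup>2 + (U \<phi> x)\<^sup>2)"
    proof (rule integral_abs_bound[THEN order_trans], rule integral_mono)
      show "integrable lborel (\<lambda>x. \<bar>T \<phi> x * U \<phi> x\<bar>)"
        by (intro integrable_abs integrable_schwartz schwartz_mult opn_schwartz[OF T \<phi>] opn_schwartz[OF U \<phi>])
      show "integrable lborel (\<lambda>x. (T \<phi> x)\<^sup>2 + (U \<phi> x)\<^sup>2)"
        using i by (rule Bochner_Integration.integrable_add)
      show "\<bar>T \<phi> x * U \<phi> x\<bar> \<le> (T \<phi> x)\<^sup>2 + (U \<phi> x)\<^sup>2" for x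
      proof -
        have "0 \<le> (\<bar>T \<phi> x\<bar> - \<bar>U \<phi> x\<bar>)\<^sup>2" "0 \<le> \<bar>T \<phi> x\<bar> * \<bar>U \<phi> x\<bar>" by simp_all
        then show ?thesis unfolding power2_diff abs_mult power2_abs by linarith
      qed
    qed
    also have "\<dots> = (LINT x|lborel. (T \<phi> x)\<^sup>2) + (LINT x|lborel. (U \<phi> x)\<^sup>2)"
      using i by (rule Bochner_Integration.integral_add)
    also have "\<dots> \<le> (C + D) * inner_p p \<phi> \<phi>"
      unfolding distrib_right by (intro add_mono C D \<phi>)
    finally show ?thesis .
  qed
  then show ?thesis unfolding controlled_def by blast
qed

text \<open>The product u \<partial>_j u is half the derivative of u^2. Integration by parts
  therefore reproduces the integral with the opposite sign and leaves a derivative of F.\<close>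

lemma integral_mult_partial_self:
  assumes F: "symb m F" and u: "u \<in> schwartz"
  shows "2 * (LINT x|lborel. F x * u x * partial j u x) = - (LINT x|lborel. partial j F x * u x * u x)"
proof -
  have Fu: "(\<lambda>x. F x * u x) \<in> schwartz" by (rule symb_times_schwartz[OF F u])
  have i: "integrable lborel (\<lambda>x. F x * u x * partial j u x)" "integrable lborel (\<lambda>x. partial j F x * u x * u x)"
    by (intro integrable_schwartz schwartz_mult symb_times_schwartz[OF F] symb_times_schwartz[OF symb_partial[OF F]]
        schwartz_partial u)+
  have "(LINT x|lborel. F x * u x * partial j u x) = - (LINT x|lborel. partial j (\<lambda>x. F x * u x) x * u x)"
    by (rule integration_by_parts_partial[OF Fu u])
  also have "\<dots> = - (LINT x|lborel. F x * u x * partial j u x + partial j F x * u x * u x)"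
    by (simp add: partial_mult_smooth symb_smooth[OF F] schwartz_smooth[OF u] algebra_simps)
  also have "\<dots> = - (LINT x|lborel. F x * u x * partial j u x) - (LINT x|lborel. partial j F x * u x * u x)"
    using i by simp
  finally show ?thesis by linarith
qed

text \<open>T \<phi> already has full order, so its derivative is not controlled alone; paired with
  T \<phi> it moves onto F. The growth of F drops out and only \<partial>_j F must be bounded, which
  covers bounded coefficients (m = 0) and the drift (m = 1).\<close>

lemma controlled_mult_partial_self:
  assumes T: "opn (2 * p) T" and F: "symb m F" "symb 0 (partial j F)"
  shows "controlled p (\<lambda>\<phi>. LINT x|lborel. F x * T \<phi> x * partial j (T \<phi>) x)"
proof -
  have "controlled p (\<lambda>\<phi>. (- 1 / 2) * (LINT x|lborel. (partial j F x * T \<phi> x) * T \<phi> x))"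
    by (intro controlled_cmult controlled_inner opn_mult0 T F)
  then show ?thesis
  proof (rule controlled_cong)
    fix \<phi> :: "real ^ 'a \<Rightarrow> real" assume "\<phi> \<in> schwartz"
    from integral_mult_partial_self[OF F(1) opn_schwartz[OF T this], of j]
    show "(LINT x|lborel. F x * T \<phi> x * partial j (T \<phi>) x)
      = (- 1 / 2) * (LINT x|lborel. (partial j F x * T \<phi> x) * T \<phi> x)" by linarith
  qed
qed

lemma controlled_mult_vfield_self:
  assumes T: "opn (2 * p) T" and a: "symb 0 a" and b: "\<And>j. symb 0 (b j)"
  shows "controlled p (\<lambda>\<phi>. LINT x|lborel. a x * T \<phi> x * vfield b (T \<phi>) x)"
proof -
  have ab: "symb 0 (\<lambda>x. a x * b j x)" for j by (rule symb_mult0[OF a b])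
  have "controlled p (\<lambda>\<phi>. \<Sum>j\<in>UNIV. LINT x|lborel. (a x * b j x) * T \<phi> x * partial j (T \<phi>) x)"
    by (intro controlled_sum controlled_mult_partial_self[OF T ab symb_partial[OF ab]])
  then show ?thesis
  proof (rule controlled_cong)
    fix \<phi> :: "real ^ 'a \<Rightarrow> real" assume \<phi>: "\<phi> \<in> schwartz"
    have i: "integrable lborel (\<lambda>x. a x * b j x * T \<phi> x * partial j (T \<phi>) x)" for j
      by (intro integrable_schwartz schwartz_mult symb_times_schwartz[OF ab] schwartz_partial opn_schwartz[OF T \<phi>])
    have "a x * T \<phi> x * vfield b (T \<phi>) x = (\<Sum>j\<in>UNIV. (a x * b j x) * T \<phi> x * partial j (T \<phi>) x)" for x
      by (simp add: vfield_def sum_distrib_left mult_ac)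
    then show "(LINT x|lborel. a x * T \<phi> x * vfield b (T \<phi>) x)
      = (\<Sum>j\<in>UNIV. LINT x|lborel. (a x * b j x) * T \<phi> x * partial j (T \<phi>) x)"
      using i by (simp add: Bochner_Integration.integral_sum)
  qed
qed

lemma schwartz_vfield: "(\<And>j. symb 0 (b j)) \<Longrightarrow> \<phi> \<in> schwartz \<Longrightarrow> vfield b \<phi> \<in> schwartz"
  by (rule opn_schwartz[OF opn_vfield])

text \<open>The formal adjoint of a vector field D is - D - div b.\<close>

lemma integration_by_parts_vfield:
  assumes b: "\<And>j. symb 0 (b j)" and \<phi>: "\<phi> \<in> schwartz" and \<psi>: "\<psi> \<in> schwartz"
  shows "(LINT x|lborel. \<phi> x * vfield b \<psi> x)
    = - (LINT x|lborel. vfield b \<phi> x * \<psi> x) - (LINT x|lborel. (\<Sum>j\<in>UNIV. partial j (b j) x) * \<phi> x * \<psi> x)"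
proof -
  have bs: "(\<lambda>x. b j x * \<phi> x) \<in> schwartz" for j by (rule symb_times_schwartz[OF b \<phi>])
  have i: "integrable lborel (\<lambda>x. b j x * \<phi> x * partial j \<psi> x)"
    "integrable lborel (\<lambda>x. b j x * partial j \<phi> x * \<psi> x)"
    "integrable lborel (\<lambda>x. partial j (b j) x * \<phi> x * \<psi> x)" for j
    by (intro integrable_schwartz schwartz_mult symb_times_schwartz[OF b] symb_times_schwartz[OF symb_partial[OF b]]
        schwartz_partial \<phi> \<psi>)+
  have "\<phi> x * vfield b \<psi> x = (\<Sum>j\<in>UNIV. b j x * \<phi> x * partial j \<psi> x)" for x
    by (simp add: vfield_def sum_distrib_left mult_ac)
  then have "(LINT x|lborel. \<phi> x * vfield b \<psi> x) = (\<Sum>j\<in>UNIV. LINT x|lborel. b j x * \<phi> x * partial j \<psi> x)"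
    by (simp only: Bochner_Integration.integral_sum[OF i(1)])
  also have "\<dots> = (\<Sum>j\<in>UNIV. - (LINT x|lborel. b j x * partial j \<phi> x * \<psi> x + partial j (b j) x * \<phi> x * \<psi> x))"
    by (rule sum.cong)
       (simp_all add: integration_by_parts_partial[OF bs \<psi>] partial_mult_smooth symb_smooth[OF b] schwartz_smooth[OF \<phi>] distrib_right)
  also have "\<dots> = - (\<Sum>j\<in>UNIV. LINT x|lborel. b j x * partial j \<phi> x * \<psi> x)
      - (\<Sum>j\<in>UNIV. LINT x|lborel. partial j (b j) x * \<phi> x * \<psi> x)"
    using i by (simp add: sum.distrib sum_negf sum_subtractf)
  also have "(\<Sum>j\<in>UNIV. LINT x|lborel. b j x * partial j \<phi> x * \<psi> x) = (LINT x|lborel. vfield b \<phi> x * \<psi> x)"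
    by (simp only: vfield_def sum_distrib_right Bochner_Integration.integral_sum[OF i(2)])
  also have "(\<Sum>j\<in>UNIV. LINT x|lborel. partial j (b j) x * \<phi> x * \<psi> x)
      = (LINT x|lborel. (\<Sum>j\<in>UNIV. partial j (b j) x) * \<phi> x * \<psi> x)"
    by (simp only: sum_distrib_right Bochner_Integration.integral_sum[OF i(3)])
  finally show ?thesis .
qed

section \<open>The monotonicity inequality\<close>

lemma vfield_add:
  "smooth \<phi> \<Longrightarrow> smooth \<psi> \<Longrightarrow> vfield b (\<lambda>x. \<phi> x + \<psi> x) = (\<lambda>x. vfield b \<phi> x + vfield b \<psi> x)"
  by (simp add: vfield_def[abs_def] partial_add_smooth distrib_left sum.distrib)

text \<open>Writing \<open>D\<close> for the vector field, \<open>u = T \<phi>\<close>, \<open>v = D u\<close>, \<open>s = [T, D] \<phi>\<close>, \<open>r = [[T, D], D] \<phi>\<close> and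
  \<open>k = [T, h] \<phi>\<close>, one has \<open>T D D \<phi> = D v + 2 D s + r\<close> and \<open>T (D \<phi> + h \<phi>) = v + s + k + h u\<close>.
  After one integration by parts the terms \<open>\<langle>v, v\<rangle>\<close> and \<open>\<langle>v, s\<rangle>\<close> cancel, while \<open>\<langle>v, u\<rangle>\<close> and \<open>\<langle>v, k\<rangle>\<close> lose
  their derivative on \<open>u\<close> by a further one.\<close>

lemma controlled_energy:
  assumes c: "symb (int m) c" "m + length ks \<le> 2 * p"
    and b: "\<And>j. symb 0 (b j)" and h: "symb 0 h"
    and T: "T = (\<lambda>\<phi> x. c x * pd ks \<phi> x)"
  shows "controlled p (\<lambda>\<phi>. (LINT x|lborel. T \<phi> x * T (vfield b (vfield b \<phi>)) x)
    + (LINT x|lborel. (T (\<lambda>x. vfield b \<phi> x + h x * \<phi> x) x)\<^sup>2))"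
proof -
  let ?n = "2 * p" and ?D = "vfield b"
  \<comment> \<open>The divergence of b, the zeroth-order term in the adjoint of
    \<open>?D\<close>.\<close>
  define d where "d x = (\<Sum>j\<in>UNIV. partial j (b j) x)" for x
  define S where "S \<phi> x = T (?D \<phi>) x - ?D (T \<phi>) x" for \<phi> x
  define R where "R \<phi> x = S (?D \<phi>) x - ?D (S \<phi>) x" for \<phi> x
  define K where "K \<phi> x = T (\<lambda>x. h x * \<phi> x) x - h x * T \<phi> x" for \<phi> x
  \<comment> \<open>What remains of T (D \<phi> + h \<phi>) besides v. All its terms have order 2 p,
    so its square is controlled as it stands.\<close>
  define N where "N \<phi> x = S \<phi> x + K \<phi> x + h x * T \<phi> x" for \<phi> x
  have d: "symb 0 d" unfolding d_def[abs_def] by (intro symb_sum symb_partial b)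
  have oT: "opn ?n T" unfolding T by (rule opn.basic[OF c refl])
  have oS: "opn ?n S" unfolding S_def[abs_def] by (rule opn_commutator_vfield[OF oT b])
  have oR: "opn ?n R" unfolding R_def[abs_def] by (rule opn_commutator_vfield[OF oS b])
  have oK: "opn ?n K" "opn ?n (\<lambda>\<phi>. partial j (K \<phi>))" for j
    unfolding K_def[abs_def] T by (rule opn_commutator_mult_basic[OF h c])+
  have oDK: "opn ?n (\<lambda>\<phi>. ?D (K \<phi>))"
    unfolding vfield_def[abs_def] by (intro opn_sum opn_mult0[OF oK(2) b])
  have oN: "opn ?n N" unfolding N_def[abs_def] by (intro opn_add oS oK(1) opn_mult0[OF oT h])
  \<comment> \<open>The outcome of the integrations by parts after cancellation. Every term pairs
    two operators of order 2 p, except the two with \<open>?D (T \<phi>)\<close>, where the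
    derivative falls on the same function it is paired with.\<close>
  let ?B = "\<lambda>\<phi>. - (LINT x|lborel. d x * T \<phi> x * ?D (T \<phi>) x) - 2 * (LINT x|lborel. d x * T \<phi> x * S \<phi> x)
      + (LINT x|lborel. T \<phi> x * R \<phi> x) - 2 * (LINT x|lborel. ?D (K \<phi>) x * T \<phi> x)
      - 2 * (LINT x|lborel. d x * K \<phi> x * T \<phi> x) + 2 * (LINT x|lborel. h x * T \<phi> x * ?D (T \<phi>) x)
      + (LINT x|lborel. N \<phi> x * N \<phi> x)"
  have "controlled p (\<lambda>\<phi>. - 1 * (LINT x|lborel. d x * T \<phi> x * ?D (T \<phi>) x))"
    by (intro controlled_cmult controlled_mult_vfield_self[OF oT d b])
  then have "controlled p ?B"
    by (intro controlled_add controlled_diff controlled_cmult controlled_inner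
        controlled_mult_vfield_self[OF oT h b] opn_mult0[OF _ d] oT oS oR oK(1) oDK oN) simp
  then show ?thesis
  proof (rule controlled_cong)
    fix \<phi> :: "real ^ 'a \<Rightarrow> real" assume \<phi>: "\<phi> \<in> schwartz"
    define u v s r k w where "u = T \<phi>" and "v = ?D u" and "s = S \<phi>" and "r = R \<phi>" and "k = K \<phi>" and "w = N \<phi>"
    have Su: "u \<in> schwartz" unfolding u_def by (rule opn_schwartz[OF oT \<phi>])
    have Sv: "v \<in> schwartz" unfolding v_def by (rule schwartz_vfield[OF b Su])
    have Ss: "s \<in> schwartz" unfolding s_def by (rule opn_schwartz[OF oS \<phi>])
    have Sr: "r \<in> schwartz" unfolding r_def by (rule opn_schwartz[OF oR \<phi>])
    have Sk: "k \<in> schwartz" unfolding k_def by (rule opn_schwartz[OF oK(1) \<phi>])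
    have Sw: "w \<in> schwartz" unfolding w_def by (rule opn_schwartz[OF oN \<phi>])
    have SD: "?D \<phi> \<in> schwartz" by (rule schwartz_vfield[OF b \<phi>])
    have Sh: "(\<lambda>x. h x * \<phi> x) \<in> schwartz" by (rule symb_times_schwartz[OF h \<phi>])
    have Dv: "?D v \<in> schwartz" by (rule schwartz_vfield[OF b Sv])
    have Ds: "?D s \<in> schwartz" by (rule schwartz_vfield[OF b Ss])
    have TD: "T (?D \<phi>) = (\<lambda>x. v x + s x)" by (simp add: v_def s_def S_def u_def)
    \<comment> \<open>T passes the outer field and S the inner one: T D \<phi> = v + s gives D v + D
      s, and S D \<phi> = D s + r gives the second D s.\<close>
    have "T (?D (?D \<phi>)) x = ?D (T (?D \<phi>)) x + S (?D \<phi>) x" for x by (simp add: S_def)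
    then have TDD: "T (?D (?D \<phi>)) x = ?D v x + 2 * ?D s x + r x" for x
      unfolding TD vfield_add[OF schwartz_smooth[OF Sv] schwartz_smooth[OF Ss]]
      by (simp add: r_def R_def s_def)
    have TA: "T (\<lambda>x. ?D \<phi> x + h x * \<phi> x) x = v x + w x" for x
      unfolding opn_additive[OF oT SD Sh] TD by (simp add: w_def N_def K_def s_def u_def)
    have w: "w x = s x + k x + h x * u x" for x
      by (simp add: w_def N_def s_def k_def u_def)
    have int: "integrable lborel (\<lambda>x. f x * g x)" if "f \<in> schwartz" "g \<in> schwartz" for f g :: "real ^ 'a \<Rightarrow> real"
      by (intro integrable_schwartz schwartz_mult that)
    have Shu: "(\<lambda>x. h x * u x) \<in> schwartz" by (rule symb_times_schwartz[OF h Su])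
    note ints = int[OF Su Dv] int[OF Su Ds] int[OF Su Sr] int[OF Sv Sv] int[OF Sv Ss] int[OF Sk Sv]
      int[OF Shu Sv] int[OF Sw Sw]
    have 1: "(LINT x|lborel. u x * T (?D (?D \<phi>)) x)
      = (LINT x|lborel. u x * ?D v x) + 2 * (LINT x|lborel. u x * ?D s x) + (LINT x|lborel. u x * r x)"
    proof -
      have "(LINT x|lborel. u x * T (?D (?D \<phi>)) x)
          = (LINT x|lborel. u x * ?D v x + 2 * (u x * ?D s x) + u x * r x)"
        by (simp add: TDD algebra_simps)
      then show ?thesis using ints by simp
    qed
    have 2: "(LINT x|lborel. (v x + w x)\<^sup>2) = (LINT x|lborel. v x * v x) + 2 * (LINT x|lborel. v x * s x)
      + 2 * (LINT x|lborel. k x * v x) + 2 * (LINT x|lborel. h x * u x * v x) + (LINT x|lborel. w x * w x)"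
    proof -
      have "(v x + w x)\<^sup>2 = v x * v x + 2 * (v x * s x) + 2 * (k x * v x) + 2 * (h x * u x * v x) + w x * w x" for x
      proof -
        have "(v x + w x)\<^sup>2 = v x * v x + 2 * (v x * w x) + w x * w x"
          by (simp add: power2_eq_square algebra_simps)
        moreover have "v x * w x = v x * s x + k x * v x + h x * u x * v x"
          by (simp add: w algebra_simps)
        ultimately show ?thesis by simp
      qed
      then show ?thesis using ints by simp
    qed
    have 3: "(LINT x|lborel. u x * ?D v x) = - (LINT x|lborel. v x * v x) - (LINT x|lborel. d x * u x * v x)"
      using integration_by_parts_vfield[OF b Su Sv] by (simp add: v_def d_def)
    have 4: "(LINT x|lborel. u x * ?D s x) = - (LINT x|lborel. v x * s x) - (LINT x|lborel. d x * u x * s x)"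
      using integration_by_parts_vfield[OF b Su Ss] by (simp add: v_def d_def)
    have 5: "(LINT x|lborel. k x * v x) = - (LINT x|lborel. ?D k x * u x) - (LINT x|lborel. d x * k x * u x)"
      using integration_by_parts_vfield[OF b Sk Su] by (simp add: v_def d_def)
    have "(LINT x|lborel. u x * T (?D (?D \<phi>)) x) + (LINT x|lborel. (T (\<lambda>x. ?D \<phi> x + h x * \<phi> x) x)\<^sup>2)
      = - (LINT x|lborel. d x * u x * v x) - 2 * (LINT x|lborel. d x * u x * s x)
      + (LINT x|lborel. u x * r x) - 2 * (LINT x|lborel. ?D k x * u x)
      - 2 * (LINT x|lborel. d x * k x * u x) + 2 * (LINT x|lborel. h x * u x * v x)
      + (LINT x|lborel. w x * w x)"
      unfolding TA 1 2 3 4 5 by (simp add: algebra_simps)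
    then show "(LINT x|lborel. T \<phi> x * T (?D (?D \<phi>)) x)
      + (LINT x|lborel. (T (\<lambda>x. ?D \<phi> x + h x * \<phi> x) x)\<^sup>2) = ?B \<phi>"
      by (simp only: v_def u_def s_def r_def k_def w_def)
  qed
qed

text \<open>The degree lost by differentiating the monomial pays for the linear growth of F. By the
  Leibniz rule the property is multiplicative, so it only has to be checked for constants and
  coordinates, without a formula for the lowered exponent.\<close>

lemma symb_mult_partial_monomial:
  assumes F: "symb 1 F"
  shows "symb (int (mi_order \<alpha>)) (\<lambda>x. F x * partial j (monomial \<alpha>) x)"
proof -
  define good where "good m c \<longleftrightarrow> symb m c \<and> symb m (\<lambda>x. F x * partial j c x)" for m c
  have one: "good 0 (\<lambda>x. 1)" by (simp add: good_def)
  have comp: "good 1 (\<lambda>x. x $ i)" for i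
    using F by (auto simp: good_def symb_component partial_component)
  have mult: "good (m + l) (\<lambda>x. f x * g x)" if "good m f" "good l g" for m l f g
  proof -
    have s: "symb m f" "symb m (\<lambda>x. F x * partial j f x)" "symb l g" "symb l (\<lambda>x. F x * partial j g x)"
      using that by (auto simp: good_def)
    have "symb (m + l) (\<lambda>x. f x * (F x * partial j g x) + (F x * partial j f x) * g x)"
      by (intro symb_add symb_mult s)
    then have "symb (m + l) (\<lambda>x. F x * partial j (\<lambda>x. f x * g x) x)"
      by (simp add: partial_mult_smooth symb_smooth[OF s(1)] symb_smooth[OF s(3)] algebra_simps)
    then show ?thesis using symb_mult[OF s(1,3)] by (simp add: good_def)
  qed
  have power: "good (int k) (\<lambda>x. x $ i ^ k)" for i k
  proof (induction k)
    case (Suc k)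
    from mult[OF comp this] show ?case by simp
  qed (simp add: one)
  have "good (int (\<Sum>i\<in>I. \<alpha> i)) (\<lambda>x. \<Prod>i\<in>I. (x $ i) ^ \<alpha> i)" if "finite I" for I
    using that
  proof (induction I rule: finite_induct)
    case (insert i I)
    from mult[OF power insert.IH] show ?case using insert by simp
  qed (simp add: one)
  from this[of UNIV] show ?thesis by (simp add: good_def monomial_def[abs_def] mi_order_def)
qed

text \<open>Commuting T past the drift leaves F (T \<phi>) \<partial>_j (T \<phi>), a self-pairing,
  and an operator of order 2 p. The coefficient of T must be a monomial for the latter.\<close>

lemma controlled_drift:
  assumes F: "\<And>k. symb 0 (partial k F)" "smooth F" and ks: "mi_order \<alpha> + length ks \<le> 2 * p"
    and T: "T = (\<lambda>\<phi> x. monomial \<alpha> x * pd ks \<phi> x)"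
  shows "controlled p (\<lambda>\<phi>. LINT x|lborel. T \<phi> x * T (\<lambda>x. F x * partial j \<phi> x) x)"
proof -
  have F1: "symb 1 F" by (rule symb1_of_partial[OF F(2,1)])
  define N where "N \<phi> x = T (\<lambda>x. F x * partial j \<phi> x) x - F x * partial j (T \<phi>) x" for \<phi> x
  have oT: "opn (2 * p) T" unfolding T by (rule opn.basic[OF symb_monomial ks refl])
  have oN: "opn (2 * p) N" unfolding N_def[abs_def] T
    by (rule opn_commutator_partial_basic[OF F symb_monomial ks symb_mult_partial_monomial[OF F1]])
  have "controlled p (\<lambda>\<phi>. (LINT x|lborel. F x * T \<phi> x * partial j (T \<phi>) x) + (LINT x|lborel. T \<phi> x * N \<phi> x))"
    by (intro controlled_add controlled_inner oT oN controlled_mult_partial_self[OF oT F1 F(1)])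
  then show ?thesis
  proof (rule controlled_cong)
    fix \<phi> :: "real ^ 'a \<Rightarrow> real" assume \<phi>: "\<phi> \<in> schwartz"
    note S = opn_schwartz[OF oT \<phi>] opn_schwartz[OF oN \<phi>]
    have "T \<phi> x * T (\<lambda>x. F x * partial j \<phi> x) x = F x * T \<phi> x * partial j (T \<phi>) x + T \<phi> x * N \<phi> x" for x
      by (simp add: N_def algebra_simps)
    moreover have "integrable lborel (\<lambda>x. F x * T \<phi> x * partial j (T \<phi>) x)" "integrable lborel (\<lambda>x. T \<phi> x * N \<phi> x)"
      by (intro integrable_schwartz schwartz_mult symb_times_schwartz[OF F1] schwartz_partial S)+
    ultimately show "(LINT x|lborel. T \<phi> x * T (\<lambda>x. F x * partial j \<phi> x) x)
      = (LINT x|lborel. F x * T \<phi> x * partial j (T \<phi>) x) + (LINT x|lborel. T \<phi> x * N \<phi> x)"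
      by simp
  qed
qed

text \<open>The first-order remainder is the Stratonovich correction: half of it, summed over the
  columns of \<sigma>, is what separates L from half the sum of squares.\<close>

lemma vfield_vfield:
  assumes "\<And>j. smooth (b j)" "smooth \<phi>"
  shows "vfield b (vfield b \<phi>) x
    = (\<Sum>j\<in>UNIV. \<Sum>k\<in>UNIV. b j x * b k x * partial j (partial k \<phi>) x) + (\<Sum>k\<in>UNIV. vfield b (b k) x * partial k \<phi> x)"
proof -
  have "partial j (vfield b \<phi>) x = (\<Sum>k\<in>UNIV. b k x * partial j (partial k \<phi>) x + partial j (b k) x * partial k \<phi> x)" for j
  proof -
    have "smooth (\<lambda>x. b k x * partial k \<phi> x)" for k by (intro smooth_mult smooth_partial assms)
    then have "smooth (\<lambda>x. \<Sum>k\<in>I. b k x * partial k \<phi> x) \<and>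
      partial j (\<lambda>x. \<Sum>k\<in>I. b k x * partial k \<phi> x) x = (\<Sum>k\<in>I. partial j (\<lambda>x. b k x * partial k \<phi> x) x)" for I
      by (induction I rule: infinite_finite_induct) (auto simp: partial_add_smooth smooth_add)
    then show ?thesis
      by (simp add: vfield_def[abs_def] partial_mult_smooth assms smooth_partial)
  qed
  then have "vfield b (vfield b \<phi>) x = (\<Sum>j\<in>UNIV. \<Sum>k\<in>UNIV. b j x * b k x * partial j (partial k \<phi>) x)
    + (\<Sum>j\<in>UNIV. \<Sum>k\<in>UNIV. b j x * partial j (b k) x * partial k \<phi> x)"
    by (simp add: vfield_def[of b "vfield b \<phi>"] sum_distrib_left distrib_left sum.distrib mult.assoc)
  also have "(\<Sum>j\<in>UNIV. \<Sum>k\<in>UNIV. b j x * partial j (b k) x * partial k \<phi> x) = (\<Sum>k\<in>UNIV. vfield b (b k) x * partial k \<phi> x)"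
    by (subst sum.swap) (simp add: vfield_def sum_distrib_right)
  finally show ?thesis .
qed

theorem theorem2p4:
  fixes \<sigma> :: "real ^ 'd::finite \<Rightarrow> real ^ 'd ^ 'd"
    and f h :: "real ^ 'd \<Rightarrow> real ^ 'd"
    and g :: "real ^ 'd \<Rightarrow> real"
    and p :: nat
  assumes "smooth g" "bounded (range g)" "bounded_derivatives g"
    and "\<And>j. smooth (\<lambda>x. h x $ j)" "\<And>j. bounded (range (\<lambda>x. h x $ j))"
      "\<And>j. bounded_derivatives (\<lambda>x. h x $ j)"
    and "\<And>i j. smooth (\<lambda>x. \<sigma> x $ i $ j)" "\<And>i j. bounded (range (\<lambda>x. \<sigma> x $ i $ j))"
      "\<And>i j. bounded_derivatives (\<lambda>x. \<sigma> x $ i $ j)"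
    and "\<And>j. smooth (\<lambda>x. f x $ j)" "\<And>j. bounded_derivatives (\<lambda>x. f x $ j)"
  shows "\<exists>C>0. \<forall>\<phi>\<in>schwartz.
    2 * inner_p p \<phi> (op_L \<sigma> f g \<phi>) + (\<Sum>i\<in>UNIV. (norm_p p (op_A \<sigma> h i \<phi>))\<^sup>2)
      \<le> C * (norm_p p \<phi>)\<^sup>2"
proof -
  have g: "symb 0 g" and h: "\<And>j. symb 0 (\<lambda>x. h x $ j)" and \<sigma>: "\<And>i j. symb 0 (\<lambda>x. \<sigma> x $ i $ j)"
    using assms by (auto intro!: symb0_of_bounded)
  \<comment> \<open>Row i of \<open>b\<close> is column i of \<sigma>, so that
    \<open>vfield (b i)\<close> is the leading part of A_i.\<close>
  define b where "b i j x = \<sigma> x $ j $ i" for i j x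
  have b: "symb 0 (b i j)" for i j unfolding b_def[abs_def] by (rule \<sigma>)
  \<comment> \<open>The drift left after L is written with squares of vector fields. It differs from
    f by a function bounded with all its derivatives, so its partials are still bounded.\<close>
  define F where "F k x = f x $ k - 1 / 2 * (\<Sum>i\<in>UNIV. vfield (b i) (b i k) x)" for k x
  have corr: "symb 0 (\<lambda>x. 1 / 2 * (\<Sum>i\<in>UNIV. vfield (b i) (b i k) x))" for k
    unfolding vfield_def by (intro symb_cmult symb_sum symb_mult0 symb_partial b)
  have F: "smooth (F k)" "symb 0 (partial j (F k))" for k j
  proof -
    have "symb 1 (\<lambda>x. f x $ k)"
      by (intro symb1_of_partial symb0_partial_of_bounded_derivatives assms)
    then have "symb 1 (F k)" unfolding F_def[abs_def] by (rule symb_diff[OF _ symb_mono[OF corr]]) simp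
    then show "smooth (F k)" by (rule symb_smooth)
    have "partial j (F k) = (\<lambda>x. partial j (\<lambda>x. f x $ k) x - partial j (\<lambda>x. 1 / 2 * (\<Sum>i\<in>UNIV. vfield (b i) (b i k) x)) x)"
      unfolding F_def[abs_def] by (rule partial_diff_smooth[OF assms(10) symb_smooth[OF corr]])
    then show "symb 0 (partial j (F k))"
      by (simp only:) (intro symb_diff symb_partial[OF corr] symb0_partial_of_bounded_derivatives assms)
  qed
  have A: "op_A \<sigma> h i \<phi> = (\<lambda>x. vfield (b i) \<phi> x + h x $ i * \<phi> x)" for i \<phi>
    by (rule ext) (simp add: op_A_def vfield_def b_def)
  have L: "op_L \<sigma> f g \<phi> = (\<lambda>x. (1 / 2 * (\<Sum>i\<in>UNIV. vfield (b i) (vfield (b i) \<phi>) x)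
      + (\<Sum>j\<in>UNIV. F j x * partial j \<phi> x)) + g x * \<phi> x)" if \<phi>: "\<phi> \<in> schwartz" for \<phi>
  proof
    fix x
    let ?P = "\<lambda>j k. partial j (partial k \<phi>) x"
    have "(\<Sum>i\<in>UNIV. vfield (b i) (vfield (b i) \<phi>) x)
      = (\<Sum>i\<in>UNIV. \<Sum>j\<in>UNIV. \<Sum>k\<in>UNIV. b i j x * b i k x * ?P j k)
      + (\<Sum>i\<in>UNIV. \<Sum>k\<in>UNIV. vfield (b i) (b i k) x * partial k \<phi> x)"
      by (simp add: vfield_vfield symb_smooth[OF b] schwartz_smooth[OF \<phi>] sum.distrib)
    \<comment> \<open>Summing over the columns i first turns the products of entries into those of
      \<sigma>\<sigma>^t.\<close>
    also have "(\<Sum>i\<in>UNIV. \<Sum>j\<in>UNIV. \<Sum>k\<in>UNIV. b i j x * b i k x * ?P j k)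
      = (\<Sum>j\<in>UNIV. \<Sum>k\<in>UNIV. (\<sigma> x ** transpose (\<sigma> x)) $ j $ k * ?P j k)"
    proof -
      have "(\<Sum>i\<in>UNIV. \<Sum>j\<in>UNIV. \<Sum>k\<in>UNIV. b i j x * b i k x * ?P j k)
        = (\<Sum>j\<in>UNIV. \<Sum>i\<in>UNIV. \<Sum>k\<in>UNIV. b i j x * b i k x * ?P j k)" by (rule sum.swap)
      also have "\<dots> = (\<Sum>j\<in>UNIV. \<Sum>k\<in>UNIV. \<Sum>i\<in>UNIV. b i j x * b i k x * ?P j k)"
        by (rule sum.cong[OF refl], rule sum.swap)
      finally show ?thesis
        by (simp add: matrix_matrix_mult_def transpose_def b_def sum_distrib_right)
    qed
    also have "(\<Sum>i\<in>UNIV. \<Sum>k\<in>UNIV. vfield (b i) (b i k) x * partial k \<phi> x)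
      = (\<Sum>k\<in>UNIV. (\<Sum>i\<in>UNIV. vfield (b i) (b i k) x) * partial k \<phi> x)"
      by (subst sum.swap) (simp add: sum_distrib_right)
    finally have DD: "(\<Sum>i\<in>UNIV. vfield (b i) (vfield (b i) \<phi>) x)
      = (\<Sum>j\<in>UNIV. \<Sum>k\<in>UNIV. (\<sigma> x ** transpose (\<sigma> x)) $ j $ k * ?P j k)
        + (\<Sum>k\<in>UNIV. (\<Sum>i\<in>UNIV. vfield (b i) (b i k) x) * partial k \<phi> x)" .
    have "(\<Sum>j\<in>UNIV. F j x * partial j \<phi> x) = (\<Sum>j\<in>UNIV. f x $ j * partial j \<phi> x)
      - 1 / 2 * (\<Sum>k\<in>UNIV. (\<Sum>i\<in>UNIV. vfield (b i) (b i k) x) * partial k \<phi> x)"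
      by (simp only: F_def left_diff_distrib sum_subtractf mult.assoc sum_distrib_left[symmetric])
    then show "op_L \<sigma> f g \<phi> x = (1 / 2 * (\<Sum>i\<in>UNIV. vfield (b i) (vfield (b i) \<phi>) x)
      + (\<Sum>j\<in>UNIV. F j x * partial j \<phi> x)) + g x * \<phi> x"
      unfolding op_L_def DD by (simp add: algebra_simps)
  qed
  define M :: "'d multi_index \<Rightarrow> 'd multi_index \<Rightarrow> (real ^ 'd \<Rightarrow> real) \<Rightarrow> real ^ 'd \<Rightarrow> real"
    where "M \<alpha> \<beta> \<phi> x = monomial \<alpha> x * mderiv \<beta> \<phi> x" for \<alpha> \<beta> \<phi> x
  \<comment> \<open>The contribution of one pair (\<alpha>, \<beta>) to the left-hand side; all
    cancellation takes place inside it.\<close>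
  define E where "E \<alpha> \<beta> \<phi> = 2 * (LINT x|lborel. M \<alpha> \<beta> \<phi> x * M \<alpha> \<beta> (op_L \<sigma> f g \<phi>) x)
    + (\<Sum>i\<in>UNIV. LINT x|lborel. (M \<alpha> \<beta> (op_A \<sigma> h i \<phi>) x)\<^sup>2)" for \<alpha> \<beta> \<phi>
  have E: "controlled p (E \<alpha> \<beta>)" if le: "mi_order \<alpha> + mi_order \<beta> \<le> 2 * p" for \<alpha> \<beta>
  proof -
    obtain ks where ks: "length ks = mi_order \<beta>" "\<And>f. mderiv \<beta> f = pd ks f"
      using mderiv_eq_pd by blast
    have le': "mi_order \<alpha> + length ks \<le> 2 * p" using le ks(1) by simp
    let ?T = "M \<alpha> \<beta>"
    have T: "?T = (\<lambda>\<phi> x. monomial \<alpha> x * pd ks \<phi> x)"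
      by (intro ext) (simp add: M_def ks(2))
    have oT: "opn (2 * p) ?T" unfolding T by (rule opn.basic[OF symb_monomial le' refl])
    have "opn (2 * p + 0) (\<lambda>\<phi>. ?T (\<lambda>x. g x * \<phi> x))" by (rule opn_comp[OF oT opn_mult_id[OF g]])
    then have oTg: "opn (2 * p) (\<lambda>\<phi>. ?T (\<lambda>x. g x * \<phi> x))" by simp
    \<comment> \<open>The factor 2 in front of the pairing with L absorbs the 1/2 of the
      second-order part, so each square D_i D_i meets exactly one A_i with the weights of
      \<open>controlled_energy\<close>.\<close>
    let ?B = "\<lambda>\<phi>. (\<Sum>i\<in>UNIV. (LINT x|lborel. ?T \<phi> x * ?T (vfield (b i) (vfield (b i) \<phi>)) x)
        + (LINT x|lborel. (?T (\<lambda>x. vfield (b i) \<phi> x + h x $ i * \<phi> x) x)\<^sup>2))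
      + 2 * (\<Sum>j\<in>UNIV. LINT x|lborel. ?T \<phi> x * ?T (\<lambda>x. F j x * partial j \<phi> x) x)
      + 2 * (LINT x|lborel. ?T \<phi> x * ?T (\<lambda>x. g x * \<phi> x) x)"
    have "controlled p ?B"
      by (intro controlled_add controlled_sum controlled_cmult
          controlled_energy[OF symb_monomial le' b h T] controlled_drift[OF F(2,1) le' T] controlled_inner[OF oT oTg])
    then show ?thesis
    proof (rule controlled_cong)
      fix \<phi> :: "real ^ 'd \<Rightarrow> real" assume \<phi>: "\<phi> \<in> schwartz"
      have F1: "symb 1 (F j)" for j by (rule symb1_of_partial[OF F])
      have SD: "vfield (b i) (vfield (b i) \<phi>) \<in> schwartz" for i by (intro schwartz_vfield b \<phi>)
      have SF: "(\<lambda>x. F j x * partial j \<phi> x) \<in> schwartz" for j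
        by (intro symb_times_schwartz[OF F1] schwartz_partial \<phi>)
      have Sg: "(\<lambda>x. g x * \<phi> x) \<in> schwartz" by (rule symb_times_schwartz[OF g \<phi>])
      have SDs: "(\<lambda>x. \<Sum>i\<in>UNIV. vfield (b i) (vfield (b i) \<phi>) x) \<in> schwartz" by (rule schwartz_sum[OF SD])
      have SDs': "(\<lambda>x. 1 / 2 * (\<Sum>i\<in>UNIV. vfield (b i) (vfield (b i) \<phi>) x)) \<in> schwartz"
        by (rule symb_times_schwartz[OF symb_const SDs])
      have SFs: "(\<lambda>x. \<Sum>j\<in>UNIV. F j x * partial j \<phi> x) \<in> schwartz" by (rule schwartz_sum[OF SF])
      have TL: "?T (op_L \<sigma> f g \<phi>) x = 1 / 2 * (\<Sum>i\<in>UNIV. ?T (vfield (b i) (vfield (b i) \<phi>)) x)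
          + (\<Sum>j\<in>UNIV. ?T (\<lambda>x. F j x * partial j \<phi> x) x) + ?T (\<lambda>x. g x * \<phi> x) x" for x
        unfolding L[OF \<phi>] opn_additive[OF oT schwartz_add[OF SDs' SFs] Sg] opn_additive[OF oT SDs' SFs]
          opn_apply_cmult[OF oT SDs] opn_apply_sum[OF oT SD] opn_apply_sum[OF oT SF] ..
      note i = integrable_schwartz[OF schwartz_mult[OF opn_schwartz[OF oT \<phi>] opn_schwartz[OF oT SD]]]
        integrable_schwartz[OF schwartz_mult[OF opn_schwartz[OF oT \<phi>] opn_schwartz[OF oT SF]]]
        integrable_schwartz[OF schwartz_mult[OF opn_schwartz[OF oT \<phi>] opn_schwartz[OF oT Sg]]]
      have "?T \<phi> x * ?T (op_L \<sigma> f g \<phi>) x = 1 / 2 * (\<Sum>i\<in>UNIV. ?T \<phi> x * ?T (vfield (b i) (vfield (b i) \<phi>)) x)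
          + (\<Sum>j\<in>UNIV. ?T \<phi> x * ?T (\<lambda>x. F j x * partial j \<phi> x) x) + ?T \<phi> x * ?T (\<lambda>x. g x * \<phi> x) x" for x
        unfolding TL sum_distrib_left[symmetric] by (simp add: algebra_simps)
      then have "(LINT x|lborel. ?T \<phi> x * ?T (op_L \<sigma> f g \<phi>) x)
        = 1 / 2 * (\<Sum>i\<in>UNIV. LINT x|lborel. ?T \<phi> x * ?T (vfield (b i) (vfield (b i) \<phi>)) x)
          + (\<Sum>j\<in>UNIV. LINT x|lborel. ?T \<phi> x * ?T (\<lambda>x. F j x * partial j \<phi> x) x)
          + (LINT x|lborel. ?T \<phi> x * ?T (\<lambda>x. g x * \<phi> x) x)"
        using i by (simp add: Bochner_Integration.integral_sum)
      then show "E \<alpha> \<beta> \<phi> = ?B \<phi>"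
        by (simp add: E_def A sum.distrib)
    qed
  qed
  let ?I = "{(\<alpha> :: 'd multi_index, \<beta> :: 'd multi_index). mi_order \<alpha> + mi_order \<beta> \<le> 2 * p}"
  have "controlled p (\<lambda>\<phi>. \<Sum>z\<in>?I. E (fst z) (snd z) \<phi>)"
    by (intro controlled_sum E) auto
  then obtain C where C: "\<And>\<phi>. \<phi> \<in> schwartz \<Longrightarrow> \<bar>\<Sum>z\<in>?I. E (fst z) (snd z) \<phi>\<bar> \<le> C * inner_p p \<phi> \<phi>"
    unfolding controlled_def by blast
  show ?thesis
  \<comment> \<open>The C from \<open>controlled\<close> carries no sign; enlarging it to a positive
    constant is harmless because \<open>inner_p p \<phi> \<phi>\<close> is nonnegative.\<close>
  proof (intro exI[of _ "max C 1"] conjI ballI)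
    fix \<phi> :: "real ^ 'd \<Rightarrow> real" assume \<phi>: "\<phi> \<in> schwartz"
    have inner: "inner_p p \<psi> \<eta> = (\<Sum>z\<in>?I. LINT x|lborel. M (fst z) (snd z) \<psi> x * M (fst z) (snd z) \<eta> x)" for \<psi> \<eta>
      by (simp add: inner_p_def M_def case_prod_beta)
    have "(\<Sum>i\<in>UNIV. (norm_p p (op_A \<sigma> h i \<phi>))\<^sup>2)
      = (\<Sum>z\<in>?I. \<Sum>i\<in>UNIV. LINT x|lborel. (M (fst z) (snd z) (op_A \<sigma> h i \<phi>) x)\<^sup>2)"
      unfolding norm_p_square unfolding inner power2_eq_square by (rule sum.swap)
    then have "2 * inner_p p \<phi> (op_L \<sigma> f g \<phi>) + (\<Sum>i\<in>UNIV. (norm_p p (op_A \<sigma> h i \<phi>))\<^sup>2)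
      = (\<Sum>z\<in>?I. E (fst z) (snd z) \<phi>)"
      unfolding E_def sum.distrib inner sum_distrib_left by simp
    also have "\<dots> \<le> C * inner_p p \<phi> \<phi>" using C[OF \<phi>] by linarith
    also have "\<dots> \<le> max C 1 * inner_p p \<phi> \<phi>" by (intro mult_right_mono inner_p_nonneg) simp
    finally show "2 * inner_p p \<phi> (op_L \<sigma> f g \<phi>) + (\<Sum>i\<in>UNIV. (norm_p p (op_A \<sigma> h i \<phi>))\<^sup>2)
      \<le> max C 1 * (norm_p p \<phi>)\<^sup>2" by (simp add: norm_p_square)
  qed simp
qed

end
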